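(* Let $T$ be a tree on $n$ vertices with a rooted labeling. If $T$ is not a path, then $\operatorname{height} I_T\leq n-2$. In particular, $S/I_T$ is not a complete intersection.
   Context: All graphs are finite and simple. Let $\mathbb{K}$ be a field, $[n]=\{1,\ldots,n\}$ and $S=\mathbb{K}[x_1,\ldots,x_{n+1}]$. For $1\le i<j\le n$ put $g_{ij}=x_ix_{j+1}-x_jx_{i+1}$. For a graph $G$ with vertex set $[n]$, the Hankel edge ideal $I_G\subset S$ is the ideal generated by the $g_{ij}$ with $i<j$ and $\{i,j\}\in E(G)$. A rooted labeling of a tree $T$ with $n$ vertices is a labeling of its vertices by $1,\ldots,n$ obtained as follows (breadth-first). Choose any vertex as the root and give it the label $1$. Then process the labeled vertices $1,2,3,\ldots$ in increasing order of label; when vertex $i$ is processed, its not-yet-labeled neighbors receive the next consecutive smallest unused labels, in an arbitrary order among themselves. (Thus, if $1$ has $t_1$ neighbors they get labels $2,\ldots,t_1+1$; the $t_2$ unlabeled neighbors of $2$ get labels $t_1+2,\ldots,t_1+t_2+1$; and so on.) The vertices of $T$ are identified with their labels. For a homogeneous ideal $I\subset S$, $\mu(I)$ is the cardinality of a minimal homogeneous generating set of $I$, and $S/I$ is a complete intersection if $\mu(I)=\operatorname{height} I$. *)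

theory Defs
  imports
    "HOL-Algebra.Ideal"
    "HOL-Library.Poly_Mapping"
    "HOL-Library.Extended_Nat"
begin

section \<open>Trees and rooted labelings\<close>

text \<open>A simple graph is a vertex set \<open>V\<close> together with a set \<open>E\<close> of two-element subsets of \<open>V\<close>.\<close>

definition finite_simple_graph :: "'v set \<Rightarrow> 'v set set \<Rightarrow> bool" where
  "finite_simple_graph V E \<longleftrightarrow> finite V \<and> (\<forall>e\<in>E. e \<subseteq> V \<and> card e = 2)"

definition connected_graph :: "'v set \<Rightarrow> 'v set set \<Rightarrow> bool" where
  "connected_graph V E \<longleftrightarrow> V \<noteq> {} \<and> (\<forall>u\<in>V. \<forall>v\<in>V. (u, v) \<in> {(a, b). {a, b} \<in> E}\<^sup>*)"

definition graph_cycle :: "'v set set \<Rightarrow> 'v list \<Rightarrow> bool" where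
  "graph_cycle E c \<longleftrightarrow> 3 \<le> length c \<and> distinct c
     \<and> (\<forall>k. Suc k < length c \<longrightarrow> {c ! k, c ! Suc k} \<in> E) \<and> {last c, hd c} \<in> E"

definition tree :: "'v set \<Rightarrow> 'v set set \<Rightarrow> bool" where
  "tree V E \<longleftrightarrow> finite_simple_graph V E \<and> connected_graph V E \<and> (\<nexists>c. graph_cycle E c)"

text \<open>The path graph; a single vertex counts as a path.\<close>

definition path_graph :: "'v set \<Rightarrow> 'v set set \<Rightarrow> bool" where
  "path_graph V E \<longleftrightarrow> (\<exists>vs. vs \<noteq> [] \<and> distinct vs \<and> set vs = V
     \<and> E = {{vs ! k, vs ! Suc k} | k. Suc k < length vs})"

text \<open>
  \<open>bfs V E i L\<close>: a possible state of the labeling procedure after the vertices with labels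
  \<open>1, \<dots>, i\<close> have been processed. The list \<open>L\<close> consists of the vertices labeled so far in increasing
  order of label, so that \<open>L ! k\<close> carries the label \<open>k + 1\<close>; \<open>ns\<close> is an arbitrary ordering of the
  not yet labeled neighbors of the vertex being processed.
\<close>

inductive bfs :: "'v set \<Rightarrow> 'v set set \<Rightarrow> nat \<Rightarrow> 'v list \<Rightarrow> bool" for V E where
  root: "r \<in> V \<Longrightarrow> bfs V E 0 [r]"
| process: "bfs V E i L \<Longrightarrow> i < length L \<Longrightarrow> distinct ns
    \<Longrightarrow> set ns = {v \<in> V. {L ! i, v} \<in> E} - set L \<Longrightarrow> bfs V E (Suc i) (L @ ns)"

definition rooted_labeling :: "'v set \<Rightarrow> 'v set set \<Rightarrow> ('v \<Rightarrow> nat) \<Rightarrow> bool" where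
  "rooted_labeling V E lab \<longleftrightarrow>
     (\<exists>L. bfs V E (length L) L \<and> set L = V \<and> (\<forall>k<length L. lab (L ! k) = k + 1))"

definition relabel_edges :: "('v \<Rightarrow> 'w) \<Rightarrow> 'v set set \<Rightarrow> 'w set set" where
  "relabel_edges lab E = (\<lambda>e. lab ` e) ` E"


section \<open>Polynomials\<close>

text \<open>
  Monomials are exponent functions of finite support. The underlying type has infinitely many
  variables; the polynomial ring in the variables indexed by \<open>1, \<dots>, m\<close> is carved out by its carrier.
\<close>

type_synonym 'k mpoly = "(nat \<Rightarrow>\<^sub>0 nat) \<Rightarrow>\<^sub>0 'k"

definition mpoly_ring :: "nat \<Rightarrow> ('k::field) mpoly ring" where
  "mpoly_ring m = \<lparr>carrier = {p. \<forall>t \<in> Poly_Mapping.keys p. Poly_Mapping.keys t \<subseteq> {1..m}},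
     mult = (*), one = 1, zero = 0, add = (+)\<rparr>"

definition mvar :: "nat \<Rightarrow> ('k::field) mpoly" where
  "mvar i = Poly_Mapping.single (Poly_Mapping.single i 1) 1"

definition monom_degree :: "(nat \<Rightarrow>\<^sub>0 nat) \<Rightarrow> nat" where
  "monom_degree t = (\<Sum>i\<in>Poly_Mapping.keys t. Poly_Mapping.lookup t i)"

definition homogeneous :: "('k::field) mpoly \<Rightarrow> bool" where
  "homogeneous p \<longleftrightarrow> (\<exists>d. \<forall>t\<in>Poly_Mapping.keys p. monom_degree t = d)"


section \<open>Height and complete intersections\<close>

definition prime_height :: "('a, 'b) ring_scheme \<Rightarrow> 'a set \<Rightarrow> enat" where
  "prime_height R P = Sup {enat k | k. \<exists>Q :: nat \<Rightarrow> 'a set.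
     (\<forall>i\<le>k. primeideal (Q i) R) \<and> (\<forall>i<k. Q i \<subset> Q (Suc i)) \<and> Q k = P}"

definition ideal_height :: "('a, 'b) ring_scheme \<Rightarrow> 'a set \<Rightarrow> enat" where
  "ideal_height R I = Inf {prime_height R P | P. primeideal P R \<and> I \<subseteq> P}"

definition homogeneous_generating_set ::
    "('k::field) mpoly ring \<Rightarrow> 'k mpoly set \<Rightarrow> 'k mpoly set \<Rightarrow> bool" where
  "homogeneous_generating_set R I B \<longleftrightarrow>
     B \<subseteq> carrier R \<and> (\<forall>b\<in>B. homogeneous b) \<and> Idl\<^bsub>R\<^esub> B = I"

definition minimal_homogeneous_generating_set ::
    "('k::field) mpoly ring \<Rightarrow> 'k mpoly set \<Rightarrow> 'k mpoly set \<Rightarrow> bool" where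
  "minimal_homogeneous_generating_set R I B \<longleftrightarrow>
     homogeneous_generating_set R I B \<and> (\<forall>B'. B' \<subset> B \<longrightarrow> \<not> homogeneous_generating_set R I B')"

text \<open>
  For a homogeneous ideal of a polynomial ring all minimal homogeneous generating sets are finite
  and have the same cardinality (graded Nakayama), so the choice below is immaterial.
  The definition is meaningful for homogeneous ideals only.
\<close>

definition num_generators :: "('k::field) mpoly ring \<Rightarrow> 'k mpoly set \<Rightarrow> nat" where
  "num_generators R I = card (SOME B. minimal_homogeneous_generating_set R I B)"

definition complete_intersection :: "('k::field) mpoly ring \<Rightarrow> 'k mpoly set \<Rightarrow> bool" where
  "complete_intersection R I \<longleftrightarrow> enat (num_generators R I) = ideal_height R I"


section \<open>Hankel edge ideals\<close>

definition hankel_binomial :: "nat \<Rightarrow> nat \<Rightarrow> ('k::field) mpoly" where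
  "hankel_binomial i j = mvar i * mvar (j + 1) - mvar j * mvar (i + 1)"

text \<open>For a graph on the vertex set \<open>{1..n}\<close> with edge set \<open>E\<close>, an ideal of \<open>mpoly_ring (n + 1)\<close>.\<close>

definition hankel_edge_ideal :: "nat \<Rightarrow> nat set set \<Rightarrow> ('k::field) mpoly set" where
  "hankel_edge_ideal n E =
     Idl\<^bsub>mpoly_ring (n + 1)\<^esub> {hankel_binomial i j | i j. i < j \<and> {i, j} \<in> E}"

end

theory Submission
  imports Defs
begin

text \<open>
  Write \<open>P j\<close> for the label of the parent of vertex \<open>j\<close>; \<open>P\<close> is monotone, and \<open>I_T\<close> is generated by
  the \<open>n - 1\<close> binomials saying that the vectors \<open>(x\<^sub>i, x\<^sub>i\<^sub>+\<^sub>1)\<close> for \<open>i = P j\<close> and \<open>i = j\<close> are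
  parallel. If \<open>T\<close> is not a path, there is some \<open>i\<close> such that either at least three labeled vertices
  are waiting after vertex \<open>i\<close> has been processed, or at least two are and all children of \<open>1\<close>
  have labels at most \<open>i\<close>. For the largest such \<open>i\<close>, setting \<open>x\<^sub>1, \<dots>, x\<^sub>i\<^sub>+\<^sub>1\<close> (in the second case
  \<open>x\<^sub>2, \<dots>, x\<^sub>i\<^sub>+\<^sub>1\<close>) to zero kills all relations up to the last waiting vertex, and the others are
  solved recursively by Laurent monomials in three free variables. The kernel of this evaluation is a
  prime containing \<open>I_T\<close> modulo which three variables are algebraically independent, so its height is
  at most \<open>(n + 1) - 3\<close>. On the other hand, \<open>n - 1\<close> generators are needed since the quadrics are
  linearly independent.
\<close>

section \<open>Ideals of the polynomial ring\<close>

lemma mpoly_ring_simps [simp]: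
  "x \<otimes>\<^bsub>mpoly_ring m\<^esub> y = x * y" "x \<oplus>\<^bsub>mpoly_ring m\<^esub> y = x + y"
  "\<one>\<^bsub>mpoly_ring m\<^esub> = 1" "\<zero>\<^bsub>mpoly_ring m\<^esub> = 0"
  by (simp_all add: mpoly_ring_def)

lemma mem_mpoly_ring:
  "p \<in> carrier (mpoly_ring m) \<longleftrightarrow> (\<forall>t\<in>Poly_Mapping.keys p. Poly_Mapping.keys t \<subseteq> {1..m})"
  by (simp add: mpoly_ring_def)

lemma zero_in_mpoly_ring [simp]: "0 \<in> carrier (mpoly_ring m)"
  by (simp add: mem_mpoly_ring)

lemma one_in_mpoly_ring [simp]: "1 \<in> carrier (mpoly_ring m)"
  by (simp add: mem_mpoly_ring)

lemma const_in_mpoly_ring [simp]: "Poly_Mapping.single 0 c \<in> carrier (mpoly_ring m)"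
  by (simp add: mem_mpoly_ring)

lemma mvar_in_mpoly_ring [simp]: "i \<in> {1..m} \<Longrightarrow> mvar i \<in> carrier (mpoly_ring m)"
  by (simp add: mem_mpoly_ring mvar_def)

lemma add_in_mpoly_ring [simp]:
  "p \<in> carrier (mpoly_ring m) \<Longrightarrow> q \<in> carrier (mpoly_ring m) \<Longrightarrow> p + q \<in> carrier (mpoly_ring m)"
  using Poly_Mapping.keys_add[of p q] by (auto simp: mem_mpoly_ring)

lemma uminus_in_mpoly_ring [simp]:
  "p \<in> carrier (mpoly_ring m) \<Longrightarrow> - p \<in> carrier (mpoly_ring m)"
  by (auto simp: mem_mpoly_ring in_keys_iff)

lemma diff_in_mpoly_ring [simp]:
  "p \<in> carrier (mpoly_ring m) \<Longrightarrow> q \<in> carrier (mpoly_ring m) \<Longrightarrow> p - q \<in> carrier (mpoly_ring m)"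
  using add_in_mpoly_ring[of p m "- q"] by simp

lemma mult_in_mpoly_ring [simp]:
  assumes "p \<in> carrier (mpoly_ring m)" "q \<in> carrier (mpoly_ring m)"
  shows "p * q \<in> carrier (mpoly_ring m)"
  unfolding mem_mpoly_ring
proof
  fix t assume "t \<in> Poly_Mapping.keys (p * q)"
  then obtain a b where "a \<in> Poly_Mapping.keys p" "b \<in> Poly_Mapping.keys q" "t = a + b"
    using keys_mult[of p q] by blast
  then show "Poly_Mapping.keys t \<subseteq> {1..m}"
    using assms Poly_Mapping.keys_add[of a b] unfolding mem_mpoly_ring by blast
qed

lemma power_in_mpoly_ring [simp]:
  "p \<in> carrier (mpoly_ring m) \<Longrightarrow> p ^ k \<in> carrier (mpoly_ring m)"
  by (induction k) simp_all

lemma sum_in_mpoly_ring: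
  "(\<And>x. x \<in> F \<Longrightarrow> f x \<in> carrier (mpoly_ring m)) \<Longrightarrow> sum f F \<in> carrier (mpoly_ring m)"
  by (induction F rule: infinite_finite_induct) auto

lemma cring_mpoly_ring: "cring (mpoly_ring m)"
proof (intro cringI abelian_groupI comm_monoidI)
  fix x :: "'a mpoly" assume "x \<in> carrier (mpoly_ring m)"
  then show "\<exists>y\<in>carrier (mpoly_ring m). y \<oplus>\<^bsub>mpoly_ring m\<^esub> x = \<zero>\<^bsub>mpoly_ring m\<^esub>"
    by (intro bexI[of _ "- x"]) simp_all
qed (simp_all add: algebra_simps)

interpretation mpoly_ring: cring "mpoly_ring m"
  by (rule cring_mpoly_ring)

lemma a_inv_mpoly_ring:
  assumes "x \<in> carrier (mpoly_ring m)" shows "\<ominus>\<^bsub>mpoly_ring m\<^esub> x = - x"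
  using assms by (intro mpoly_ring.minus_equality) simp_all

lemma ideal_mpoly_ringI:
  assumes "I \<subseteq> carrier (mpoly_ring m)" "0 \<in> I"
    and add: "\<And>x y. x \<in> I \<Longrightarrow> y \<in> I \<Longrightarrow> x + y \<in> I"
    and mult: "\<And>x y. x \<in> I \<Longrightarrow> y \<in> carrier (mpoly_ring m) \<Longrightarrow> y * x \<in> I"
  shows "ideal I (mpoly_ring m)"
proof (rule idealI)
  have "- x \<in> I" if "x \<in> I" for x
    using mult[OF that, of "- 1"] by simp
  then show "subgroup I (add_monoid (mpoly_ring m))"
    using assms by (intro mpoly_ring.add.subgroupI)
      (auto simp: a_inv_mpoly_ring a_inv_def[symmetric] subset_eq)
qed (use assms mpoly_ring.ring_axioms in \<open>auto simp: mult.commute\<close>)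

lemma ideal_mpoly_ringD:
  assumes "ideal I (mpoly_ring m)"
  shows "I \<subseteq> carrier (mpoly_ring m)" "0 \<in> I"
    and "\<And>x y. x \<in> I \<Longrightarrow> y \<in> I \<Longrightarrow> x + y \<in> I"
    and "\<And>x y. x \<in> I \<Longrightarrow> y \<in> carrier (mpoly_ring m) \<Longrightarrow> y * x \<in> I"
proof -
  interpret ideal I "mpoly_ring m" by fact
  show "I \<subseteq> carrier (mpoly_ring m)" "0 \<in> I" using a_subset zero_closed by simp_all
  show "\<And>x y. x \<in> I \<Longrightarrow> y \<in> I \<Longrightarrow> x + y \<in> I" using a_closed by simp
  show "\<And>x y. x \<in> I \<Longrightarrow> y \<in> carrier (mpoly_ring m) \<Longrightarrow> y * x \<in> I"
    using I_l_closed by simp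
qed

lemma ideal_mpoly_ring_sum:
  assumes "ideal I (mpoly_ring m)" "\<And>x. x \<in> F \<Longrightarrow> f x \<in> I"
  shows "sum f F \<in> I"
  using assms(2) by (induction F rule: infinite_finite_induct)
    (simp_all add: ideal_mpoly_ringD(2,3)[OF assms(1)])

lemma ideal_mpoly_ring_diff:
  assumes "ideal I (mpoly_ring m)" "x \<in> I" "y \<in> I"
  shows "x - y \<in> I"
  using ideal_mpoly_ringD(3)[OF assms(1,2) ideal_mpoly_ringD(4)[OF assms(1,3), of "- 1"]] by simp

text \<open>The finite combinations form an ideal containing \<open>B\<close>. Since
  \<open>B\<close> may be infinite, each element carries its own finite support
  \<open>F\<close>.\<close>

lemma genideal_mpoly_ring_combination:
  fixes p :: "('k::field) mpoly"
  assumes "p \<in> Idl\<^bsub>mpoly_ring m\<^esub> B" "B \<subseteq> carrier (mpoly_ring m)"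
  shows "\<exists>F s. finite F \<and> F \<subseteq> B \<and> (\<forall>b\<in>F. s b \<in> carrier (mpoly_ring m)) \<and> p = (\<Sum>b\<in>F. s b * b)"
proof -
  define J :: "'k mpoly set" where "J = {p. \<exists>F s. finite F \<and> F \<subseteq> B \<and> (\<forall>b. s b \<in> carrier (mpoly_ring m)) \<and>
    p = (\<Sum>b\<in>F. s b * b)}"
  have "ideal J (mpoly_ring m)"
  proof (rule ideal_mpoly_ringI)
    show "J \<subseteq> carrier (mpoly_ring m)"
      using assms(2) by (auto simp: J_def intro!: sum_in_mpoly_ring mult_in_mpoly_ring)
    show "0 \<in> J"
      unfolding J_def by (auto intro!: exI[of _ "{}"] exI[of _ "\<lambda>_. 0"])
  next
    fix x y assume "x \<in> J" "y \<in> J"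
    from \<open>x \<in> J\<close> \<open>y \<in> J\<close> obtain F s G u where
      F: "finite F" "F \<subseteq> B" "\<forall>b. s b \<in> carrier (mpoly_ring m)" "x = (\<Sum>b\<in>F. s b * b)" and
      G: "finite G" "G \<subseteq> B" "\<forall>b. u b \<in> carrier (mpoly_ring m)" "y = (\<Sum>b\<in>G. u b * b)"
      unfolding J_def mem_Collect_eq by (elim exE conjE)
    define v where "v = (\<lambda>b. (if b \<in> F then s b else 0) + (if b \<in> G then u b else 0))"
    have "x = (\<Sum>b\<in>F \<union> G. (if b \<in> F then s b else 0) * b)"
      unfolding F(4) by (rule sum.mono_neutral_cong_left) (use F G in auto)
    moreover have "y = (\<Sum>b\<in>F \<union> G. (if b \<in> G then u b else 0) * b)"
      unfolding G(4) by (rule sum.mono_neutral_cong_left) (use F G in auto)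
    ultimately have "x + y = (\<Sum>b\<in>F \<union> G. v b * b)"
      by (simp only: v_def distrib_right sum.distrib)
    moreover have "\<forall>b. v b \<in> carrier (mpoly_ring m)"
      using F(3) G(3) by (simp add: v_def)
    moreover have "finite (F \<union> G)" "F \<union> G \<subseteq> B" using F G by auto
    ultimately show "x + y \<in> J" unfolding J_def mem_Collect_eq
      by (intro exI[of _ "F \<union> G"] exI[of _ v]) simp
  next
    fix x y :: "'k mpoly" assume "x \<in> J" "y \<in> carrier (mpoly_ring m)"
    then obtain F s where
      F: "finite F" "F \<subseteq> B" "\<forall>b. s b \<in> carrier (mpoly_ring m)" "x = (\<Sum>b\<in>F. s b * b)"
      unfolding J_def mem_Collect_eq by (elim exE conjE)
    have "y * x = (\<Sum>b\<in>F. (y * s b) * b)"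
      by (simp add: F(4) sum_distrib_left mult.assoc)
    moreover have "\<forall>b. y * s b \<in> carrier (mpoly_ring m)"
      using F(3) \<open>y \<in> _\<close> by simp
    ultimately show "y * x \<in> J" using F(1,2) unfolding J_def mem_Collect_eq
      by (intro exI[of _ F] exI[of _ "\<lambda>b. y * s b"]) simp
  qed
  moreover have "B \<subseteq> J"
  proof
    fix b assume "b \<in> B"
    then show "b \<in> J" unfolding J_def mem_Collect_eq
      by (intro exI[of _ "{b}"] exI[of _ "\<lambda>_. 1"]) simp
  qed
  ultimately have "Idl\<^bsub>mpoly_ring m\<^esub> B \<subseteq> J" by (rule mpoly_ring.genideal_minimal)
  with assms(1) have "p \<in> J" by (rule rev_subsetD)
  then obtain F s where "finite F" "F \<subseteq> B" "\<forall>b. s b \<in> carrier (mpoly_ring m)" "p = (\<Sum>b\<in>F. s b * b)"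
    unfolding J_def mem_Collect_eq by (elim exE conjE)
  then show ?thesis by (intro exI[of _ F] exI[of _ s]) simp
qed

text \<open>Gaussian elimination by induction on the equations \<open>B\<close>, with unknowns
  indexed by \<open>J\<close>. It is used once with monomials as equations, to bound independent
  families, and once with ideal generators as equations, to bound their number from below.\<close>

lemma homogeneous_linear_system:
  fixes a :: "'i \<Rightarrow> 'j \<Rightarrow> 'k::field"
  assumes "finite B" "finite J" "card B < card J"
  shows "\<exists>c. (\<exists>j\<in>J. c j \<noteq> 0) \<and> (\<forall>t\<in>B. (\<Sum>j\<in>J. c j * a j t) = 0)"
  using assms
proof (induction B arbitrary: J a rule: finite_induct)
  case empty
  then obtain j where "j \<in> J" by (auto simp: card_gt_0_iff)
  then show ?case by (intro exI[of _ "\<lambda>_. 1"]) auto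
next
  case (insert t B)
  show ?case
  proof (cases "\<forall>j\<in>J. a j t = 0")
    case True
    moreover have "card B < card J" using insert by simp
    ultimately show ?thesis using insert.IH[OF insert.prems(1), of a] by auto
  next
    case False
    then obtain j0 where j0: "j0 \<in> J" "a j0 t \<noteq> 0" by blast
    \<comment> \<open>Elimination with pivot \<open>a j0 t\<close>: the coefficients left once
      equation \<open>t\<close> is solved for the unknown \<open>j0\<close>.\<close>
    define a' where "a' j s = a j s - a j t / a j0 t * a j0 s" for j s
    have "card B < card (J - {j0})" "finite (J - {j0})" using insert j0 by auto
    then obtain c j1 where c: "j1 \<in> J - {j0}" "c j1 \<noteq> 0"
      "\<And>s. s \<in> B \<Longrightarrow> (\<Sum>j\<in>J - {j0}. c j * a' j s) = 0"
      using insert.IH[of "J - {j0}" a'] by blast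
    \<comment> \<open>Back substitution: the value at \<open>j0\<close> is the one forced by
      equation \<open>t\<close>.\<close>
    define d where "d = c (j0 := - (\<Sum>j\<in>J - {j0}. c j * (a j t / a j0 t)))"
    have *: "(\<Sum>j\<in>J. d j * a j s) = (\<Sum>j\<in>J - {j0}. c j * a' j s)" for s
    proof -
      have "(\<Sum>j\<in>J. d j * a j s) = d j0 * a j0 s + (\<Sum>j\<in>J - {j0}. c j * a j s)"
        using insert.prems(1) j0(1) by (subst sum.remove[of _ j0]) (auto simp: d_def intro!: sum.cong)
      then show ?thesis
        by (simp add: d_def a'_def sum_subtractf sum_distrib_right right_diff_distrib mult.assoc)
    qed
    have "a' j t = 0" for j using j0(2) by (simp add: a'_def)
    then have "(\<Sum>j\<in>J. d j * a j t) = 0" unfolding * by simp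
    moreover have "\<forall>s\<in>B. (\<Sum>j\<in>J. d j * a j s) = 0" unfolding * using c(3) by blast
    moreover have "j1 \<in> J" "d j1 \<noteq> 0" using c(1,2) by (auto simp: d_def)
    ultimately show ?thesis by (intro exI[of _ d]) auto
  qed
qed

section \<open>Heights of primes in the polynomial ring\<close>

text \<open>Each exponent is bounded separately, rather than the total degree, so that the number of
  monomials is exactly a power of \<open>N + 1\<close>.\<close>

definition exponent_box :: "nat set \<Rightarrow> nat \<Rightarrow> (nat \<Rightarrow>\<^sub>0 nat) set" where
  "exponent_box A N = {t. Poly_Mapping.keys t \<subseteq> A \<and> (\<forall>i. Poly_Mapping.lookup t i \<le> N)}"

lemma exponent_box_bij:
  assumes "finite A"
  shows "bij_betw (\<lambda>t. restrict (Poly_Mapping.lookup t) A) (exponent_box A N) (A \<rightarrow>\<^sub>E {..N})"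
proof (rule bij_betw_byWitness[where f' = "\<lambda>f. Abs_poly_mapping (\<lambda>i. if i \<in> A then f i else 0)"])
  have fin: "finite {i. (if i \<in> A then f i else 0) \<noteq> (0::nat)}" for f
    using finite_subset[OF _ assms] by (metis (mono_tags, lifting) mem_Collect_eq subsetI)
  show "\<forall>t\<in>exponent_box A N.
      Abs_poly_mapping (\<lambda>i. if i \<in> A then restrict (Poly_Mapping.lookup t) A i else 0) = t"
  proof
    fix t assume "t \<in> exponent_box A N"
    then have "(\<lambda>i. if i \<in> A then restrict (Poly_Mapping.lookup t) A i else 0) = Poly_Mapping.lookup t"
      by (auto simp: exponent_box_def fun_eq_iff in_keys_iff subset_eq)
    then show "Abs_poly_mapping (\<lambda>i. if i \<in> A then restrict (Poly_Mapping.lookup t) A i else 0) = t"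
      by simp
  qed
  show "\<forall>f\<in>A \<rightarrow>\<^sub>E {..N}.
      restrict (Poly_Mapping.lookup (Abs_poly_mapping (\<lambda>i. if i \<in> A then f i else 0))) A = f"
    by (auto simp: lookup_Abs_poly_mapping[OF fin] fun_eq_iff PiE_def extensional_def)
  show "(\<lambda>t. restrict (Poly_Mapping.lookup t) A) ` exponent_box A N \<subseteq> A \<rightarrow>\<^sub>E {..N}"
    by (auto simp: exponent_box_def)
  show "(\<lambda>f. Abs_poly_mapping (\<lambda>i. if i \<in> A then f i else 0)) ` (A \<rightarrow>\<^sub>E {..N}) \<subseteq> exponent_box A N"
    by (auto simp: exponent_box_def lookup_Abs_poly_mapping[OF fin] in_keys_iff split: if_splits)
qed

lemma card_exponent_box: "finite A \<Longrightarrow> card (exponent_box A N) = Suc N ^ card A"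
  using bij_betw_same_card[OF exponent_box_bij] by (simp add: card_PiE)

lemma finite_exponent_box: "finite A \<Longrightarrow> finite (exponent_box A N)"
  using bij_betw_finite[OF exponent_box_bij] by (simp add: finite_PiE)

definition exponents_bounded :: "nat \<Rightarrow> 'k::zero mpoly \<Rightarrow> bool" where
  "exponents_bounded N p \<longleftrightarrow> (\<forall>t\<in>Poly_Mapping.keys p. \<forall>i. Poly_Mapping.lookup t i \<le> N)"

lemma exponents_bounded_mono: "exponents_bounded M p \<Longrightarrow> M \<le> N \<Longrightarrow> exponents_bounded N p"
  unfolding exponents_bounded_def using le_trans by blast

lemma exponents_bounded_ex: "\<exists>N. exponents_bounded N p"
proof
  \<comment> \<open>The \<open>0\<close> accounts for the variables that do not occur in
    \<open>t\<close>.\<close>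
  let ?S = "\<Union>t\<in>Poly_Mapping.keys p. insert 0 (Poly_Mapping.lookup t ` Poly_Mapping.keys t)"
  have "Poly_Mapping.lookup t i \<in> ?S" if "t \<in> Poly_Mapping.keys p" for t i
    using that by (cases "i \<in> Poly_Mapping.keys t") (blast, force simp: in_keys_iff)
  then show "exponents_bounded (Max ?S) p"
    unfolding exponents_bounded_def by (intro ballI allI Max_ge) auto
qed

lemma exponents_bounded_mult:
  assumes "exponents_bounded M p" "exponents_bounded N q"
  shows "exponents_bounded (M + N) (p * q)"
  unfolding exponents_bounded_def
proof (intro ballI allI)
  fix t i assume "t \<in> Poly_Mapping.keys (p * q)"
  then obtain a b where "a \<in> Poly_Mapping.keys p" "b \<in> Poly_Mapping.keys q" "t = a + b"
    using keys_mult[of p q] by blast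
  then show "Poly_Mapping.lookup t i \<le> M + N"
    using assms by (auto simp: exponents_bounded_def lookup_add intro: add_mono)
qed

lemma exponents_bounded_power:
  "exponents_bounded M p \<Longrightarrow> exponents_bounded (k * M) (p ^ k)"
  by (induction k) (auto simp: exponents_bounded_def[of _ 1] dest: exponents_bounded_mult)

section \<open>Linear independence modulo primes and its growth along chains\<close>

text \<open>\<open>Poly_Mapping.single 0 (c j)\<close> is the constant polynomial
  \<open>c j\<close>, so this is independence over the field in the quotient by \<open>Q\<close>. It
  concerns indexed families: a repetition counts as a dependence.\<close>

definition lin_indep_mod :: "('k::field) mpoly set \<Rightarrow> 'i set \<Rightarrow> ('i \<Rightarrow> 'k mpoly) \<Rightarrow> bool" where
  "lin_indep_mod Q J u \<longleftrightarrow>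
     (\<forall>c. (\<Sum>j\<in>J. Poly_Mapping.single 0 (c j) * u j) \<in> Q \<longrightarrow> (\<forall>j\<in>J. c j = 0))"

lemma lin_indep_mod_reindex:
  assumes "lin_indep_mod Q J u" "bij_betw h J' J"
  shows "lin_indep_mod Q J' (u \<circ> h)"
  unfolding lin_indep_mod_def
proof (intro allI impI ballI)
  fix c j assume *: "(\<Sum>j\<in>J'. Poly_Mapping.single 0 (c j) * (u \<circ> h) j) \<in> Q" and j: "j \<in> J'"
  have inv: "the_inv_into J' h (h i) = i" if "i \<in> J'" for i
    using that assms(2) by (simp add: bij_betw_def the_inv_into_f_f)
  have "(\<Sum>j\<in>J'. Poly_Mapping.single 0 (c j) * (u \<circ> h) j)
      = (\<Sum>j\<in>J. Poly_Mapping.single 0 (c (the_inv_into J' h j)) * u j)"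
    by (subst sum.reindex_bij_betw[OF assms(2), symmetric]) (auto simp: inv intro!: sum.cong)
  with * have "\<forall>j\<in>J. c (the_inv_into J' h j) = 0"
    using assms(1) unfolding lin_indep_mod_def by metis
  then show "c j = 0" using j inv assms(2) by (metis bij_betwE)
qed

lemma primeideal_power_cancel:
  assumes "primeideal Q (mpoly_ring m)" "f \<in> carrier (mpoly_ring m)" "f \<notin> Q"
    "x \<in> carrier (mpoly_ring m)" "f ^ a * x \<in> Q"
  shows "x \<in> Q"
  using assms(5)
proof (induction a)
  case (Suc a)
  have "f \<in> Q \<or> f ^ a * x \<in> Q"
    using primeideal.I_prime[OF assms(1), of f "f ^ a * x"] Suc.prems assms(2,4)
    by (simp add: mult.assoc)
  then show ?case using Suc.IH assms(3) by blast
qed simp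

text \<open>
  In a relation \<open>\<Sum>\<^sub>a f\<^sup>a h\<^sub>a \<in> Q\<close> one may cancel \<open>f\<close> until some \<open>h\<^sub>a\<close> is the lowest term; as
  \<open>f \<in> Q'\<close>, that \<open>h\<^sub>a\<close> then lies in \<open>Q'\<close>. So every strict inclusion of primes contributes one more
  algebraically independent element.
\<close>

lemma lin_indep_mod_powers:
  assumes Q: "primeideal Q (mpoly_ring m)" and Q': "ideal Q' (mpoly_ring m)" "Q \<subseteq> Q'"
    and f: "f \<in> Q'" "f \<notin> Q"
    and u: "lin_indep_mod Q' J u" "\<And>j. j \<in> J \<Longrightarrow> u j \<in> carrier (mpoly_ring m)"
  shows "lin_indep_mod Q ({..D} \<times> J) (\<lambda>(a, j). f ^ a * u j)"
  unfolding lin_indep_mod_def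
proof (intro allI impI)
  fix c :: "nat \<times> 'b \<Rightarrow> 'a"
  \<comment> \<open>The relation is grouped by powers of \<open>f\<close>; \<open>h a\<close> is the
    coefficient of \<open>f ^ a\<close>.\<close>
  define h where "h a = (\<Sum>j\<in>J. Poly_Mapping.single 0 (c (a, j)) * u j)" for a
  have fc: "f \<in> carrier (mpoly_ring m)" using ideal_mpoly_ringD(1)[OF Q'(1)] f(1) by blast
  have hc: "h a \<in> carrier (mpoly_ring m)" for a
    unfolding h_def by (intro sum_in_mpoly_ring mult_in_mpoly_ring u(2)) simp_all
  assume "(\<Sum>x\<in>{..D} \<times> J. Poly_Mapping.single 0 (c x) * (case x of (a, j) \<Rightarrow> f ^ a * u j)) \<in> Q"
  also have "(\<Sum>x\<in>{..D} \<times> J. Poly_Mapping.single 0 (c x) * (case x of (a, j) \<Rightarrow> f ^ a * u j))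
      = (\<Sum>a\<le>D. f ^ a * h a)"
    unfolding h_def sum_distrib_left sum.cartesian_product by (intro sum.cong) (auto simp: ac_simps)
  finally have sQ: "(\<Sum>a\<le>D. f ^ a * h a) \<in> Q" .
  have "\<forall>j\<in>J. c (a, j) = 0" if "a \<le> D" for a
    using that
  proof (induction a rule: less_induct)
    case (less a)
    have h0: "h b = 0" if "b < a" for b
      using less.IH[OF that] that less.prems by (simp add: h_def)
    \<comment> \<open>The tail beyond \<open>f ^ a\<close> with \<open>f ^ (a + 1)\<close> divided
      out, so that the whole sum becomes \<open>f ^ a * (h a + f * r)\<close>.\<close>
    define r where "r = (\<Sum>b\<in>{a<..D}. f ^ (b - a - 1) * h b)"
    have "(\<Sum>b\<le>D. f ^ b * h b) = (\<Sum>b\<in>{a..D}. f ^ b * h b)"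
      by (rule sum.mono_neutral_right) (use h0 in auto)
    also have "\<dots> = f ^ a * h a + (\<Sum>b\<in>{a<..D}. f ^ b * h b)"
      using less.prems by (rule sum.head)
    also have "(\<Sum>b\<in>{a<..D}. f ^ b * h b) = f ^ a * (f * r)"
      unfolding r_def sum_distrib_left
    proof (rule sum.cong)
      fix b assume "b \<in> {a<..D}"
      then have "f ^ b = f ^ (a + 1 + (b - a - 1))" by simp
      then show "f ^ b * h b = f ^ a * (f * (f ^ (b - a - 1) * h b))"
        unfolding power_add by (simp add: ac_simps)
    qed simp
    finally have "f ^ a * (h a + f * r) \<in> Q"
      using sQ by (simp add: distrib_left)
    moreover have rc: "r \<in> carrier (mpoly_ring m)"
      unfolding r_def by (intro sum_in_mpoly_ring mult_in_mpoly_ring power_in_mpoly_ring hc fc)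
    ultimately have "h a + f * r \<in> Q'"
      using primeideal_power_cancel[OF Q fc f(2), of "h a + f * r"] fc hc Q'(2) by auto
    moreover have "f * r \<in> Q'"
      using ideal_mpoly_ringD(4)[OF Q'(1) f(1) rc] by (simp add: mult.commute)
    ultimately have "h a \<in> Q'"
      using ideal_mpoly_ring_diff[OF Q'(1)] by force
    then show ?case
      using spec[OF u(1)[unfolded lin_indep_mod_def], of "\<lambda>j. c (a, j)"] by (simp add: h_def)
  qed
  then show "\<forall>x\<in>{..D} \<times> J. c x = 0" by auto
qed

text \<open>
  The slope \<open>e'\<close> depends on the chain only and not on \<open>D\<close>, which is what makes the comparison of
  growth rates in \<open>D\<close> below possible.
\<close>

lemma lin_indep_mod_chain:
  assumes "\<And>i. i \<le> k \<Longrightarrow> primeideal (Q i) (mpoly_ring m)" "\<And>i. i < k \<Longrightarrow> Q i \<subset> Q (Suc i)"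
  shows "\<exists>e'. \<forall>D N u. lin_indep_mod (Q k) {..<N} u \<longrightarrow>
    (\<forall>j<N. u j \<in> carrier (mpoly_ring m) \<and> exponents_bounded (D * e) (u j)) \<longrightarrow>
    (\<exists>u'. lin_indep_mod (Q 0) {..<Suc D ^ k * N} u' \<and> (\<forall>j<Suc D ^ k * N.
      u' j \<in> carrier (mpoly_ring m) \<and> exponents_bounded (D * e') (u' j :: ('k::field) mpoly)))"
  using assms
proof (induction k arbitrary: e)
  case 0
  show ?case by (intro exI[of _ e]) auto
next
  case (Suc k)
  obtain f where f: "f \<in> Q (Suc k)" "f \<notin> Q k" using Suc.prems(2)[of k] by blast
  obtain ef where ef: "exponents_bounded ef f" using exponents_bounded_ex by blast
  have Qk: "primeideal (Q k) (mpoly_ring m)" "ideal (Q (Suc k)) (mpoly_ring m)" "Q k \<subseteq> Q (Suc k)"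
    using Suc.prems(1)[of k] Suc.prems(1)[of "Suc k"] Suc.prems(2)[of k]
    by (auto simp: primeideal_def)
  have fc: "f \<in> carrier (mpoly_ring m)" using ideal_mpoly_ringD(1)[OF Qk(2)] f(1) by blast
  \<comment> \<open>The slope grows by the exponent bound \<open>ef\<close> of \<open>f\<close>: for
    \<open>a \<le> D\<close> the product \<open>f ^ a * u j\<close> has exponents at most
    \<open>D * ef + D * e\<close>.\<close>
  obtain e' where e': "\<And>D N u. lin_indep_mod (Q k) {..<N} u \<Longrightarrow>
    (\<forall>j<N. u j \<in> carrier (mpoly_ring m) \<and> exponents_bounded (D * (ef + e)) (u j)) \<Longrightarrow>
    (\<exists>u'. lin_indep_mod (Q 0) {..<Suc D ^ k * N} u' \<and> (\<forall>j<Suc D ^ k * N.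
      u' j \<in> carrier (mpoly_ring m) \<and> exponents_bounded (D * e') (u' j)))"
    using Suc.IH[of "ef + e"] Suc.prems by auto
  show ?case
  proof (intro exI[of _ e'] allI impI)
    fix D N :: nat and u :: "nat \<Rightarrow> 'k mpoly"
    assume u: "lin_indep_mod (Q (Suc k)) {..<N} u"
      "\<forall>j<N. u j \<in> carrier (mpoly_ring m) \<and> exponents_bounded (D * e) (u j)"
    let ?w = "\<lambda>(a, j). f ^ a * u j"
    have "card ({..D} \<times> {..<N}) = Suc D * N" by (simp add: card_cartesian_product)
    then obtain h where h: "bij_betw h {..<Suc D * N} ({..D} \<times> {..<N})"
      using ex_bij_betw_nat_finite[of "{..D} \<times> {..<N}"] by (auto simp: atLeast0LessThan)
    have "lin_indep_mod (Q k) ({..D} \<times> {..<N}) ?w"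
      by (rule lin_indep_mod_powers[OF Qk f u(1)]) (use u(2) in auto)
    then have "lin_indep_mod (Q k) {..<Suc D * N} (?w \<circ> h)"
      using h by (rule lin_indep_mod_reindex)
    moreover have "(?w \<circ> h) j \<in> carrier (mpoly_ring m) \<and>
        exponents_bounded (D * (ef + e)) ((?w \<circ> h) j)" if "j < Suc D * N" for j
    proof -
      have "h j \<in> {..D} \<times> {..<N}" using bij_betwE[OF h] that by blast
      then obtain a i where ai: "h j = (a, i)" "a \<le> D" "i < N" by auto
      have "exponents_bounded (a * ef + D * e) (f ^ a * u i)"
        using ef u(2) ai by (intro exponents_bounded_mult exponents_bounded_power) auto
      moreover have "a * ef + D * e \<le> D * (ef + e)" using ai by (simp add: distrib_left)
      ultimately show ?thesis
        using ai fc u(2) by (auto intro: exponents_bounded_mono)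
    qed
    ultimately show "\<exists>u'. lin_indep_mod (Q 0) {..<Suc D ^ Suc k * N} u' \<and> (\<forall>j<Suc D ^ Suc k * N.
      u' j \<in> carrier (mpoly_ring m) \<and> exponents_bounded (D * e') (u' j))"
      using e'[of "Suc D * N" "?w \<circ> h" D] by (simp only: power_Suc2 mult.assoc) blast
  qed
qed

text \<open>Dimension count: all \<open>u j\<close> lie in the span of the \<open>Suc M ^ m\<close>
  monomials of a box, so a longer family has a nontrivial combination equal to \<open>0\<close>,
  which belongs to \<open>Q\<close>.\<close>

lemma lin_indep_mod_card_le:
  fixes u :: "nat \<Rightarrow> ('k::field) mpoly"
  assumes "lin_indep_mod Q {..<N} u" "0 \<in> Q"
    and u: "\<And>j. j < N \<Longrightarrow> u j \<in> carrier (mpoly_ring m) \<and> exponents_bounded M (u j)"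
  shows "N \<le> Suc M ^ m"
proof (rule ccontr)
  let ?B = "exponent_box {1..m} M"
  assume "\<not> N \<le> Suc M ^ m"
  then have "card ?B < card {..<N}" by (simp add: card_exponent_box)
  then obtain c where c: "\<exists>j\<in>{..<N}. c j \<noteq> 0"
    "\<forall>t\<in>?B. (\<Sum>j<N. c j * Poly_Mapping.lookup (u j) t) = 0"
    using homogeneous_linear_system[of ?B "{..<N}" "\<lambda>j. Poly_Mapping.lookup (u j)"]
    by (auto simp: finite_exponent_box)
  have "Poly_Mapping.lookup (\<Sum>j<N. Poly_Mapping.single 0 (c j) * u j) t = 0" for t
  proof -
    have "Poly_Mapping.lookup (Poly_Mapping.single 0 a * p) t = a * Poly_Mapping.lookup p t"
      for a and p :: "'k mpoly"
      by (simp add: mult_map_scale_conv_mult[symmetric] Poly_Mapping.map.rep_eq when_def)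
    then have *: "Poly_Mapping.lookup (\<Sum>j<N. Poly_Mapping.single 0 (c j) * u j) t
        = (\<Sum>j<N. c j * Poly_Mapping.lookup (u j) t)"
      by (simp add: lookup_sum)
    show ?thesis
    proof (cases "t \<in> ?B")
      case False
      then have "Poly_Mapping.lookup (u j) t = 0" if "j < N" for j
        using u[OF that] unfolding mem_mpoly_ring exponents_bounded_def exponent_box_def
        by (auto simp: in_keys_iff)
      then show ?thesis unfolding * by simp
    qed (use c(2) * in simp)
  qed
  then have "(\<Sum>j<N. Poly_Mapping.single 0 (c j) * u j) = 0" by (intro poly_mapping_eqI) simp
  then show False using assms(1,2) c(1) unfolding lin_indep_mod_def by metis
qed

text \<open>The monomials in the variables \<open>A\<close> are independent modulo
  \<open>Q k\<close>, and each step down the chain multiplies the size of the family by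
  \<open>D + 1\<close>. The resulting \<open>Suc D ^ (k + card A)\<close> independent polynomials
  have exponents at most \<open>D * e\<close>, so there are at most \<open>Suc (D * e) ^ m\<close>
  of them; the growth in \<open>D\<close> decides.\<close>

lemma prime_chain_length:
  fixes Q :: "nat \<Rightarrow> ('k::field) mpoly set"
  assumes Q: "\<And>i. i \<le> k \<Longrightarrow> primeideal (Q i) (mpoly_ring m)" "\<And>i. i < k \<Longrightarrow> Q i \<subset> Q (Suc i)"
    and A: "A \<subseteq> {1..m}"
    and indep: "\<And>p. p \<in> Q k \<Longrightarrow> (\<forall>t\<in>Poly_Mapping.keys p. Poly_Mapping.keys t \<subseteq> A) \<Longrightarrow> p = 0"
  shows "k + card A \<le> m"
proof (rule ccontr)
  assume less: "\<not> k + card A \<le> m"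
  have fin: "finite A" using A finite_subset by blast
  \<comment> \<open>Slope \<open>1\<close> fits the starting family, the monomials of
    \<open>exponent_box A D\<close>.\<close>
  obtain e where e: "\<And>D N u. lin_indep_mod (Q k) {..<N} u \<Longrightarrow>
    (\<forall>j<N. u j \<in> carrier (mpoly_ring m) \<and> exponents_bounded (D * 1) (u j)) \<Longrightarrow>
    (\<exists>u'. lin_indep_mod (Q 0) {..<Suc D ^ k * N} u' \<and> (\<forall>j<Suc D ^ k * N.
      u' j \<in> carrier (mpoly_ring m) \<and> exponents_bounded (D * e) (u' j)))"
    using lin_indep_mod_chain[of k Q m 1, OF Q] by blast
  have bound: "Suc D ^ k * Suc D ^ card A \<le> Suc (D * e) ^ m" for D
  proof -
    let ?B = "exponent_box A D"
    let ?u = "\<lambda>t. Poly_Mapping.single t (1::'k)"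
    have "lin_indep_mod (Q k) ?B ?u"
      unfolding lin_indep_mod_def
    proof (intro allI impI ballI)
      fix c t assume *: "(\<Sum>t\<in>?B. Poly_Mapping.single 0 (c t) * ?u t) \<in> Q k" and t: "t \<in> ?B"
      let ?p = "\<Sum>t\<in>?B. Poly_Mapping.single t (c t)"
      have look: "Poly_Mapping.lookup ?p t = (if t \<in> ?B then c t else 0)" for t
        by (simp add: lookup_sum lookup_single when_def finite_exponent_box[OF fin])
      then have "t \<in> ?B" if "t \<in> Poly_Mapping.keys ?p" for t
        using that by (metis in_keys_iff)
      then have "\<forall>t\<in>Poly_Mapping.keys ?p. Poly_Mapping.keys t \<subseteq> A"
        unfolding exponent_box_def by blast
      moreover have "?p \<in> Q k" using * by (simp add: mult_single)
      ultimately have "?p = 0" by (rule indep[rotated])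
      then show "c t = 0" using look[of t] t by simp
    qed
    moreover obtain h where h: "bij_betw h {..<Suc D ^ card A} ?B"
      using ex_bij_betw_nat_finite[OF finite_exponent_box[OF fin]]
      by (auto simp: atLeast0LessThan card_exponent_box[OF fin])
    ultimately have "lin_indep_mod (Q k) {..<Suc D ^ card A} (?u \<circ> h)"
      by (rule lin_indep_mod_reindex)
    moreover have "\<forall>j<Suc D ^ card A. (?u \<circ> h) j \<in> carrier (mpoly_ring m) \<and>
        exponents_bounded (D * 1) ((?u \<circ> h) j)"
      using bij_betwE[OF h] A by (auto simp: mem_mpoly_ring exponents_bounded_def exponent_box_def)
    ultimately obtain u' where u': "lin_indep_mod (Q 0) {..<Suc D ^ k * Suc D ^ card A} u'"
      "\<forall>j<Suc D ^ k * Suc D ^ card A.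
        u' j \<in> carrier (mpoly_ring m) \<and> exponents_bounded (D * e) (u' j)"
      using e by blast
    have "0 \<in> Q 0"
      using ideal_mpoly_ringD(2) Q(1)[of 0] by (auto simp: primeideal_def)
    from lin_indep_mod_card_le[OF u'(1) this] u'(2) show ?thesis by blast
  qed
  \<comment> \<open>The left side of \<open>bound\<close> has degree \<open>k + card A > m\<close> in \<open>D\<close>; this \<open>D\<close> is already too large.\<close>
  define D where "D = Suc e ^ m"
  have "Suc D ^ Suc m \<le> Suc D ^ (k + card A)"
    using less by (intro power_increasing) auto
  also have "\<dots> \<le> Suc (D * e) ^ m" using bound[of D] by (simp add: power_add)
  also have "\<dots> \<le> (Suc D * Suc e) ^ m" by (intro power_mono) auto
  also have "\<dots> = Suc D ^ m * D" by (simp only: power_mult_distrib D_def)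
  finally have "Suc D ^ m * Suc D \<le> Suc D ^ m * D" by (simp only: power_Suc2)
  then show False by (simp only: mult_le_cancel1) simp
qed

lemma prime_height_le:
  fixes P :: "('k::field) mpoly set"
  assumes "A \<subseteq> {1..m}"
    and "\<And>p. p \<in> P \<Longrightarrow> (\<forall>t\<in>Poly_Mapping.keys p. Poly_Mapping.keys t \<subseteq> A) \<Longrightarrow> p = 0"
  shows "prime_height (mpoly_ring m) P \<le> enat (m - card A)"
  unfolding prime_height_def
proof (rule Sup_least, clarify)
  fix k and Q :: "nat \<Rightarrow> 'k mpoly set"
  assume *: "\<forall>i\<le>k. primeideal (Q i) (mpoly_ring m)" "\<forall>i<k. Q i \<subset> Q (Suc i)" "P = Q k"
  have "k + card A \<le> m"
    by (rule prime_chain_length[of k Q m A]) (use * assms in auto)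
  then show "enat k \<le> enat (m - card A)" by simp
qed

section \<open>Evaluation at Laurent polynomials\<close>

text \<open>Integer exponents are used because solving the relation of vertex j for x_{j+1} divides
  by the variable of its parent.\<close>

type_synonym 'k laurent = "(nat \<Rightarrow>\<^sub>0 int) \<Rightarrow>\<^sub>0 'k"

definition eval_monom :: "(nat \<Rightarrow> 'a::comm_monoid_mult) \<Rightarrow> (nat \<Rightarrow>\<^sub>0 nat) \<Rightarrow> 'a" where
  "eval_monom x t = (\<Prod>i\<in>Poly_Mapping.keys t. x i ^ Poly_Mapping.lookup t i)"

definition eval_laurent :: "(nat \<Rightarrow> 'k laurent) \<Rightarrow> ('k::field) mpoly \<Rightarrow> 'k laurent" where
  "eval_laurent x p =
     (\<Sum>t\<in>Poly_Mapping.keys p. Poly_Mapping.single 0 (Poly_Mapping.lookup p t) * eval_monom x t)"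

lemma eval_monom_superset:
  assumes "finite F" "Poly_Mapping.keys t \<subseteq> F"
  shows "eval_monom x t = (\<Prod>i\<in>F. x i ^ Poly_Mapping.lookup t i)"
  unfolding eval_monom_def using assms
  by (intro prod.mono_neutral_left) (auto simp: in_keys_iff)

lemma eval_monom_add: "eval_monom x (s + t) = eval_monom x s * eval_monom x t"
proof -
  let ?F = "Poly_Mapping.keys s \<union> Poly_Mapping.keys t"
  show ?thesis
    using Poly_Mapping.keys_add[of s t]
    by (simp add: eval_monom_superset[of ?F] lookup_add power_add prod.distrib)
qed

lemma eval_laurent_superset:
  assumes "finite T" "Poly_Mapping.keys p \<subseteq> T"
  shows "eval_laurent x p = (\<Sum>t\<in>T. Poly_Mapping.single 0 (Poly_Mapping.lookup p t) * eval_monom x t)"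
  unfolding eval_laurent_def using assms
  by (intro sum.mono_neutral_left) (auto simp: in_keys_iff)

lemma eval_laurent_add: "eval_laurent x (p + q) = eval_laurent x p + eval_laurent x q"
proof -
  let ?T = "Poly_Mapping.keys p \<union> Poly_Mapping.keys q"
  show ?thesis
    using Poly_Mapping.keys_add[of p q]
    by (simp add: eval_laurent_superset[of ?T] lookup_add single_add distrib_right sum.distrib)
qed

lemma eval_laurent_0 [simp]: "eval_laurent x 0 = 0"
  by (simp add: eval_laurent_def)

lemma eval_laurent_sum: "eval_laurent x (sum f F) = (\<Sum>i\<in>F. eval_laurent x (f i))"
  by (induction F rule: infinite_finite_induct) (simp_all add: eval_laurent_add)

lemma eval_laurent_diff: "eval_laurent x (p - q) = eval_laurent x p - eval_laurent x q"
  using eval_laurent_add[of x "p - q" q] by (simp add: algebra_simps)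

lemma eval_laurent_single:
  "eval_laurent x (Poly_Mapping.single t c) = Poly_Mapping.single 0 c * eval_monom x t"
  by (simp add: eval_laurent_superset[of "{t}"])

lemma poly_mapping_sum_single:
  "p = (\<Sum>t\<in>Poly_Mapping.keys p. Poly_Mapping.single t (Poly_Mapping.lookup p t))"
  by (intro poly_mapping_eqI) (simp add: lookup_sum lookup_single when_def in_keys_iff)

lemma eval_laurent_mult: "eval_laurent x (p * q) = eval_laurent x p * eval_laurent x q"
proof -
  let ?P = "Poly_Mapping.keys p" and ?Q = "Poly_Mapping.keys q"
  have "p * q = (\<Sum>s\<in>?P. \<Sum>t\<in>?Q.
      Poly_Mapping.single (s + t) (Poly_Mapping.lookup p s * Poly_Mapping.lookup q t))"
    by (subst (1) poly_mapping_sum_single[of p], subst (1) poly_mapping_sum_single[of q])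
      (simp add: sum_product mult_single)
  then have "eval_laurent x (p * q) = (\<Sum>s\<in>?P. \<Sum>t\<in>?Q.
      Poly_Mapping.single 0 (Poly_Mapping.lookup p s * Poly_Mapping.lookup q t) *
      (eval_monom x s * eval_monom x t))"
    by (simp add: eval_laurent_sum eval_laurent_single eval_monom_add)
  also have "\<dots> = eval_laurent x p * eval_laurent x q"
    unfolding eval_laurent_def sum_product
  proof (intro sum.cong refl)
    fix s t
    have "Poly_Mapping.single 0 (Poly_Mapping.lookup p s * Poly_Mapping.lookup q t) =
      (Poly_Mapping.single 0 (Poly_Mapping.lookup p s) *
       Poly_Mapping.single 0 (Poly_Mapping.lookup q t) :: 'a laurent)"
      by (simp add: mult_single)
    then show "Poly_Mapping.single 0 (Poly_Mapping.lookup p s * Poly_Mapping.lookup q t) *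
        (eval_monom x s * eval_monom x t) =
      Poly_Mapping.single 0 (Poly_Mapping.lookup p s) * eval_monom x s *
        (Poly_Mapping.single 0 (Poly_Mapping.lookup q t) * eval_monom x t)"
      by (simp only: ac_simps)
  qed
  finally show ?thesis .
qed

lemma eval_laurent_1 [simp]: "eval_laurent x 1 = 1"
  using eval_laurent_single[of x 0 1] by (simp add: eval_monom_def)

lemma eval_laurent_mvar [simp]: "eval_laurent x (mvar i) = x i"
  by (simp add: mvar_def eval_laurent_single eval_monom_def)

text \<open>Laurent polynomials form an integral domain, so the kernel is prime; it is proper
  because \<open>1\<close> evaluates to \<open>1\<close>.\<close>

lemma primeideal_eval_laurent_kernel:
  "primeideal {p \<in> carrier (mpoly_ring m). eval_laurent x p = 0} (mpoly_ring m)"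
proof (rule primeidealI)
  let ?K = "{p \<in> carrier (mpoly_ring m). eval_laurent x p = 0}"
  show "ideal ?K (mpoly_ring m)"
    by (rule ideal_mpoly_ringI) (auto simp: eval_laurent_add eval_laurent_mult)
  show "carrier (mpoly_ring m) \<noteq> ?K"
    using one_in_mpoly_ring[of m] by (metis (mono_tags, lifting) eval_laurent_1 mem_Collect_eq zero_neq_one)
qed (use cring_mpoly_ring in \<open>auto simp: eval_laurent_mult\<close>)

text \<open>On polynomials in the variables \<open>A\<close> the evaluation only reads exponents as
  integers. The map \<open>w\<close> doing this is injective, so the coefficient of \<open>t\<close>
  reappears at \<open>w t\<close>.\<close>

lemma eval_laurent_eq_0_free_variables:
  assumes x: "\<And>i. i \<in> A \<Longrightarrow> x i = Poly_Mapping.single (Poly_Mapping.single i 1) 1"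
    and p: "\<forall>t\<in>Poly_Mapping.keys p. Poly_Mapping.keys t \<subseteq> A" "eval_laurent x p = 0"
  shows "p = (0 :: ('k::field) mpoly)"
proof (rule poly_mapping_eqI)
  fix t
  define w :: "(nat \<Rightarrow>\<^sub>0 nat) \<Rightarrow> (nat \<Rightarrow>\<^sub>0 int)" where
    "w t = (\<Sum>i\<in>Poly_Mapping.keys t. Poly_Mapping.single i (int (Poly_Mapping.lookup t i)))" for t
  have look: "Poly_Mapping.lookup (w t) i = int (Poly_Mapping.lookup t i)" for t i
    by (simp add: w_def lookup_sum lookup_single when_def in_keys_iff)
  have "inj w" by (rule injI, rule poly_mapping_eqI) (metis look of_nat_eq_iff)
  have pow: "Poly_Mapping.single (Poly_Mapping.single i 1) 1 ^ k
      = (Poly_Mapping.single (Poly_Mapping.single i (int k)) 1 :: 'k laurent)" for i :: nat and k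
    by (induction k) (simp_all add: mult_single single_add[symmetric])
  have prod: "(\<Prod>i\<in>F. Poly_Mapping.single (e i) 1) = (Poly_Mapping.single (sum e F) 1 :: 'k laurent)"
    if "finite F" for F :: "nat set" and e
    using that by (induction F rule: finite_induct) (simp_all add: mult_single)
  have mon: "eval_monom x s = Poly_Mapping.single (w s) 1" if "s \<in> Poly_Mapping.keys p" for s
  proof -
    have "eval_monom x s = (\<Prod>i\<in>Poly_Mapping.keys s.
        Poly_Mapping.single (Poly_Mapping.single i (int (Poly_Mapping.lookup s i))) 1)"
      unfolding eval_monom_def
    proof (rule prod.cong)
      fix i assume "i \<in> Poly_Mapping.keys s"
      then have "i \<in> A" using p(1) that by blast
      then show "x i ^ Poly_Mapping.lookup s i
          = Poly_Mapping.single (Poly_Mapping.single i (int (Poly_Mapping.lookup s i))) 1"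
        by (simp only: x pow)
    qed simp
    then show ?thesis by (simp add: prod w_def)
  qed
  have "eval_laurent x p = (\<Sum>s\<in>Poly_Mapping.keys p. Poly_Mapping.single (w s) (Poly_Mapping.lookup p s))"
    unfolding eval_laurent_def by (intro sum.cong) (simp_all add: mon mult_single)
  then have "0 = (\<Sum>s\<in>Poly_Mapping.keys p. Poly_Mapping.lookup p s when w s = w t)"
    using p(2) by (metis (no_types, lifting) lookup_single lookup_sum lookup_zero sum.cong)
  also have "\<dots> = Poly_Mapping.lookup p t"
    using \<open>inj w\<close> by (simp add: inj_eq when_def in_keys_iff)
  finally show "Poly_Mapping.lookup p t = Poly_Mapping.lookup 0 t" by simp
qed

text \<open>The kernel of the evaluation at \<open>x\<close> is a prime containing \<open>G\<close>.
  The variables in \<open>A\<close> evaluate to themselves and so stay algebraically independent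
  modulo it, which bounds the height of this prime.\<close>

lemma ideal_height_le:
  assumes A: "A \<subseteq> {1..m}" "\<And>i. i \<in> A \<Longrightarrow> x i = Poly_Mapping.single (Poly_Mapping.single i 1) 1"
    and G: "G \<subseteq> carrier (mpoly_ring m)" "\<And>g. g \<in> G \<Longrightarrow> eval_laurent x g = 0"
  shows "ideal_height (mpoly_ring m) (Idl\<^bsub>mpoly_ring m\<^esub> G) \<le> enat (m - card A)"
proof -
  define P where "P = {p \<in> carrier (mpoly_ring m). eval_laurent x p = 0}"
  have P: "primeideal P (mpoly_ring m)"
    unfolding P_def by (rule primeideal_eval_laurent_kernel)
  have "Idl\<^bsub>mpoly_ring m\<^esub> G \<subseteq> P"
    using P G by (intro mpoly_ring.genideal_minimal) (auto simp: P_def primeideal_def)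
  then have "ideal_height (mpoly_ring m) (Idl\<^bsub>mpoly_ring m\<^esub> G) \<le> prime_height (mpoly_ring m) P"
    unfolding ideal_height_def using P by (intro Inf_lower) blast
  also have "\<dots> \<le> enat (m - card A)"
    by (rule prime_height_le[OF A(1)]) (auto simp: P_def intro: eval_laurent_eq_0_free_variables A(2))
  finally show ?thesis .
qed

lemma hankel_binomial_in_mpoly_ring:
  "i \<in> {1..n} \<Longrightarrow> j \<in> {1..n} \<Longrightarrow> hankel_binomial i j \<in> carrier (mpoly_ring (n + 1))"
  unfolding hankel_binomial_def
  by (intro diff_in_mpoly_ring mult_in_mpoly_ring mvar_in_mpoly_ring) auto

section \<open>Minimal numbers of generators\<close>

lemma monom_degree_superset:
  assumes "finite F" "Poly_Mapping.keys t \<subseteq> F"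
  shows "monom_degree t = (\<Sum>i\<in>F. Poly_Mapping.lookup t i)"
  unfolding monom_degree_def using assms
  by (intro sum.mono_neutral_left) (auto simp: in_keys_iff)

lemma monom_degree_add [simp]: "monom_degree (s + t) = monom_degree s + monom_degree t"
proof -
  let ?F = "Poly_Mapping.keys s \<union> Poly_Mapping.keys t"
  show ?thesis
    using Poly_Mapping.keys_add[of s t]
    by (simp add: monom_degree_superset[of ?F] lookup_add sum.distrib)
qed

lemma monom_degree_single [simp]: "monom_degree (Poly_Mapping.single i k) = k"
  by (simp add: monom_degree_superset[of "{i}"])

lemma monom_degree_0_iff [simp]: "monom_degree t = 0 \<longleftrightarrow> t = 0"
  by (auto simp: monom_degree_def in_keys_iff intro!: poly_mapping_eqI)

lemma hankel_binomial_eq: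
  "hankel_binomial i j =
     Poly_Mapping.single (Poly_Mapping.single i 1 + Poly_Mapping.single (j + 1) 1) 1 -
     Poly_Mapping.single (Poly_Mapping.single j 1 + Poly_Mapping.single (i + 1) 1) 1"
  by (simp add: hankel_binomial_def mvar_def mult_single)

lemma monom_degree_hankel_binomial:
  "t \<in> Poly_Mapping.keys (hankel_binomial i j) \<Longrightarrow> monom_degree t = 2"
  unfolding hankel_binomial_eq
  by (drule subsetD[OF keys_diff]) (auto split: if_splits)

lemma homogeneous_hankel_binomial: "homogeneous (hankel_binomial i j)"
  unfolding homogeneous_def using monom_degree_hankel_binomial by blast

lemma single_pair_eq_iff:
  assumes "a < b" "c < (d::nat)"
  shows "Poly_Mapping.single a (1::nat) + Poly_Mapping.single b 1
      = Poly_Mapping.single c 1 + Poly_Mapping.single d 1 \<longleftrightarrow> a = c \<and> b = d"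
proof
  assume *: "Poly_Mapping.single a (1::nat) + Poly_Mapping.single b 1
      = Poly_Mapping.single c 1 + Poly_Mapping.single d 1"
  have "Poly_Mapping.lookup (Poly_Mapping.single a (1::nat) + Poly_Mapping.single b 1) i =
    Poly_Mapping.lookup (Poly_Mapping.single c 1 + Poly_Mapping.single d 1) i" for i
    using * by simp
  from this[of a] this[of b] show "a = c \<and> b = d"
    using assms by (auto simp: lookup_add lookup_single when_def split: if_splits)
qed simp

text \<open>Triangularity, the source of linear independence: x_p x_{j+1} serves as leading
  monomial. The second monomial x_{j'} x_{p'+1} cannot equal it, because \<open>j'\<close> and
  \<open>p' + 1\<close> are at most \<open>j\<close>.\<close>

lemma lookup_hankel_binomial_top:
  assumes "p < j" "p' < j'" "j' \<le> j"
  shows "Poly_Mapping.lookup (hankel_binomial p' j')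
      (Poly_Mapping.single p 1 + Poly_Mapping.single (j + 1) 1) = (if p = p' \<and> j = j' then 1 else (0 :: 'k::field))"
proof -
  have "Poly_Mapping.single p' (1::nat) + Poly_Mapping.single (j' + 1) 1 =
      Poly_Mapping.single p 1 + Poly_Mapping.single (j + 1) 1 \<longleftrightarrow> p' = p \<and> j' = j"
    using assms by (subst single_pair_eq_iff) auto
  moreover have "Poly_Mapping.single j' (1::nat) + Poly_Mapping.single (p' + 1) 1 \<noteq>
      Poly_Mapping.single p 1 + Poly_Mapping.single (j + 1) 1"
  proof
    assume *: "Poly_Mapping.single j' (1::nat) + Poly_Mapping.single (p' + 1) 1 =
      Poly_Mapping.single p 1 + Poly_Mapping.single (j + 1) 1"
    have "Poly_Mapping.lookup (Poly_Mapping.single j' (1::nat) + Poly_Mapping.single (p' + 1) 1) (j + 1) = 0"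
      using assms by (simp add: lookup_add lookup_single)
    then show False unfolding * by (simp add: lookup_add)
  qed
  ultimately show ?thesis
    unfolding hankel_binomial_eq by (auto simp: lookup_minus lookup_single when_def)
qed

text \<open>Every monomial of an element of the ideal is a multiple of a monomial of some
  generator.\<close>

lemma keys_ideal_degree_ge:
  assumes G: "G \<subseteq> carrier (mpoly_ring m)"
    and deg: "\<And>g t. g \<in> G \<Longrightarrow> t \<in> Poly_Mapping.keys g \<Longrightarrow> d \<le> monom_degree t"
    and p: "p \<in> Idl\<^bsub>mpoly_ring m\<^esub> G" "t \<in> Poly_Mapping.keys p"
  shows "d \<le> monom_degree t"
proof -
  obtain F s where F: "finite F" "F \<subseteq> G" "p = (\<Sum>g\<in>F. s g * g)"
    using genideal_mpoly_ring_combination[OF p(1) G] by blast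
  obtain g where "g \<in> F" "t \<in> Poly_Mapping.keys (s g * g)"
    using p(2) keys_sum[of "\<lambda>g. s g * g" F] unfolding F(3) by blast
  then obtain a b where "t = a + b" "b \<in> Poly_Mapping.keys g"
    using keys_mult[of "s g" g] by blast
  then show ?thesis using deg[of g b] F(2) \<open>g \<in> F\<close> by auto
qed

text \<open>Graded Nakayama in degree two. Every \<open>b\<close> in \<open>B\<close> has only
  monomials of degree at least two, so when a quadric is written as a combination of
  \<open>B\<close>, only the constant terms of the coefficients matter in degree two. With fewer
  than \<open>n - 1\<close> generators, some nontrivial combination of the quadrics loses all these
  constant terms and starts in degree three, against linear independence.\<close>

lemma card_generators_ge:
  fixes P :: "nat \<Rightarrow> nat"
  assumes P: "\<And>j. j \<in> {2..n} \<Longrightarrow> 1 \<le> P j \<and> P j < j"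
    and G: "G = (\<lambda>j. hankel_binomial (P j) j :: ('k::field) mpoly) ` {2..n}"
    and B: "B \<subseteq> carrier (mpoly_ring (n + 1))" "finite B"
      "Idl\<^bsub>mpoly_ring (n + 1)\<^esub> B = Idl\<^bsub>mpoly_ring (n + 1)\<^esub> G"
  shows "n - 1 \<le> card B"
proof (rule ccontr)
  assume less: "\<not> n - 1 \<le> card B"
  let ?g = "\<lambda>j. hankel_binomial (P j) j :: 'k mpoly"
  have G': "G \<subseteq> carrier (mpoly_ring (n + 1))"
  proof -
    have "?g j \<in> carrier (mpoly_ring (n + 1))" if "j \<in> {2..n}" for j
      using P[OF that] that by (intro hankel_binomial_in_mpoly_ring) auto
    then show ?thesis unfolding G by blast
  qed
  have "\<exists>s. ?g j = (\<Sum>b\<in>B. s b * b)" if j: "j \<in> {2..n}" for j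
  proof -
    have "?g j \<in> Idl\<^bsub>mpoly_ring (n + 1)\<^esub> B"
      using B(3) mpoly_ring.genideal_self[OF G'] G j by blast
    from genideal_mpoly_ring_combination[OF this B(1)] obtain F s where
      F: "F \<subseteq> B" "?g j = (\<Sum>b\<in>F. s b * b)" by blast
    have "?g j = (\<Sum>b\<in>B. (if b \<in> F then s b else 0) * b)"
      unfolding F(2) by (rule sum.mono_neutral_cong_left) (use F(1) B(2) in auto)
    then show ?thesis by (rule exI[of _ "\<lambda>b. if b \<in> F then s b else 0"])
  qed
  then obtain s where s: "\<And>j. j \<in> {2..n} \<Longrightarrow> ?g j = (\<Sum>b\<in>B. s j b * b)" by metis
  \<comment> \<open>One equation for each \<open>b\<close>: the constant term of its coefficient in
    the combination vanishes.\<close>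
  have "card B < card {2..n}" using less by simp
  then obtain c where c: "\<exists>j\<in>{2..n}. c j \<noteq> 0"
    "\<forall>b\<in>B. (\<Sum>j\<in>{2..n}. c j * Poly_Mapping.lookup (s j b) 0) = 0"
    using homogeneous_linear_system[of B "{2..n}" "\<lambda>j b. Poly_Mapping.lookup (s j b) 0"] B(2)
    by auto
  have scale: "Poly_Mapping.lookup (Poly_Mapping.single 0 a * p) t = a * Poly_Mapping.lookup p t"
    for a t and p :: "'k mpoly"
    by (simp add: mult_map_scale_conv_mult[symmetric] Poly_Mapping.map.rep_eq when_def)
  define r where "r b = (\<Sum>j\<in>{2..n}. Poly_Mapping.single 0 (c j) * s j b)" for b
  have r0: "Poly_Mapping.lookup (r b) 0 = 0" if "b \<in> B" for b
    using c(2) that by (simp add: r_def lookup_sum scale)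
  have comb: "(\<Sum>j\<in>{2..n}. Poly_Mapping.single 0 (c j) * ?g j) = (\<Sum>b\<in>B. r b * b)"
  proof -
    have "(\<Sum>j\<in>{2..n}. Poly_Mapping.single 0 (c j) * ?g j)
        = (\<Sum>j\<in>{2..n}. \<Sum>b\<in>B. Poly_Mapping.single 0 (c j) * s j b * b)"
      by (intro sum.cong refl) (simp only: s sum_distrib_left mult.assoc)
    then show ?thesis by (simp add: r_def sum_distrib_right sum.swap[of _ B])
  qed
  have deg: "3 \<le> monom_degree t" if tk: "t \<in> Poly_Mapping.keys (\<Sum>b\<in>B. r b * b)" for t
  proof -
    obtain b where b: "b \<in> B" "t \<in> Poly_Mapping.keys (r b * b)"
      using tk keys_sum[of "\<lambda>b. r b * b" B] by blast
    then obtain t1 t2 where t: "t = t1 + t2" "t1 \<in> Poly_Mapping.keys (r b)" "t2 \<in> Poly_Mapping.keys b"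
      using keys_mult[of "r b" b] by blast
    have "b \<in> Idl\<^bsub>mpoly_ring (n + 1)\<^esub> G"
      using B(3) mpoly_ring.genideal_self[OF B(1)] b(1) by blast
    moreover have "2 \<le> monom_degree t'" if "g \<in> G" "t' \<in> Poly_Mapping.keys g" for g t'
      using that monom_degree_hankel_binomial unfolding G by fastforce
    ultimately have "2 \<le> monom_degree t2"
      using keys_ideal_degree_ge[OF G'] t(3) by blast
    moreover
    have "t1 \<noteq> 0" using r0[OF b(1)] t(2) by (auto simp: in_keys_iff)
    then have "1 \<le> monom_degree t1" using monom_degree_0_iff[of t1] by linarith
    ultimately show ?thesis using t(1) by simp
  qed
  \<comment> \<open>The last quadric that occurs: its leading monomial \<open>?t\<close> appears in
    no earlier one and therefore survives.\<close>
  define j where "j = Max {j \<in> {2..n}. c j \<noteq> 0}"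
  have "j \<in> {j \<in> {2..n}. c j \<noteq> 0}" unfolding j_def using c(1) by (intro Max_in) auto
  then have j: "j \<in> {2..n}" "c j \<noteq> 0" by auto
  have jmax: "c i = 0" if "i \<in> {2..n}" "j < i" for i
    using Max_ge[of "{j \<in> {2..n}. c j \<noteq> 0}" i] that unfolding j_def[symmetric] by auto
  let ?t = "Poly_Mapping.single (P j) (1::nat) + Poly_Mapping.single (j + 1) 1"
  have "c i * Poly_Mapping.lookup (?g i) ?t = (if i = j then c j else 0)" if "i \<in> {2..n}" for i
  proof (cases "i \<le> j")
    case True
    then show ?thesis
      using P[OF that] P[OF j(1)] by (subst lookup_hankel_binomial_top) auto
  qed (use jmax that in auto)
  then have "Poly_Mapping.lookup (\<Sum>j\<in>{2..n}. Poly_Mapping.single 0 (c j) * ?g j) ?t = c j"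
    using j(1) by (simp add: lookup_sum scale)
  then have "?t \<in> Poly_Mapping.keys (\<Sum>b\<in>B. r b * b)"
    using j(2) by (simp add: comb in_keys_iff)
  from deg[OF this] show False by simp
qed

section \<open>Existence and finiteness of minimal generating sets\<close>

lemma minimal_homogeneous_generating_set_ex:
  assumes "finite G" "homogeneous_generating_set R I G"
  shows "\<exists>B. minimal_homogeneous_generating_set R I B"
proof -
  have "finite {B. B \<subseteq> G \<and> homogeneous_generating_set R I B}" using assms(1) by simp
  moreover have "{B. B \<subseteq> G \<and> homogeneous_generating_set R I B} \<noteq> {}" using assms(2) by blast
  ultimately obtain B where B: "B \<subseteq> G" "homogeneous_generating_set R I B"
    "\<And>B'. B' \<subseteq> G \<Longrightarrow> homogeneous_generating_set R I B' \<Longrightarrow> B' \<subseteq> B \<Longrightarrow> B = B'"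
    using finite_has_minimal[of "{B. B \<subseteq> G \<and> homogeneous_generating_set R I B}"] by auto
  have "minimal_homogeneous_generating_set R I B"
    unfolding minimal_homogeneous_generating_set_def
  proof (intro conjI allI impI notI)
    fix B' assume "B' \<subset> B" "homogeneous_generating_set R I B'"
    then show False using B(3)[of B'] B(1) by auto
  qed (rule B(2))
  then show ?thesis ..
qed

text \<open>Each \<open>g\<close> in \<open>G\<close> uses finitely many elements of
  \<open>B\<close>; their union \<open>H\<close> already generates \<open>I\<close>, so
  \<open>H = B\<close> by minimality. This matters because \<open>num_generators\<close> takes
  \<open>card\<close> of an arbitrary minimal set, and \<open>card\<close> is 0 on infinite
  sets.\<close>

lemma minimal_homogeneous_generating_set_finite:
  assumes G: "finite G" "G \<subseteq> carrier (mpoly_ring m)" "I = Idl\<^bsub>mpoly_ring m\<^esub> G"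
    and B: "minimal_homogeneous_generating_set (mpoly_ring m) I B"
  shows "finite B"
proof -
  have B': "B \<subseteq> carrier (mpoly_ring m)" "\<forall>b\<in>B. homogeneous b" "Idl\<^bsub>mpoly_ring m\<^esub> B = I"
    using B unfolding minimal_homogeneous_generating_set_def homogeneous_generating_set_def by auto
  have "\<forall>g\<in>G. \<exists>F. finite F \<and> F \<subseteq> B \<and> g \<in> Idl\<^bsub>mpoly_ring m\<^esub> F"
  proof
    fix g assume g: "g \<in> G"
    have "g \<in> Idl\<^bsub>mpoly_ring m\<^esub> B"
      using B'(3) G(3) mpoly_ring.genideal_self[OF G(2)] g by blast
    from genideal_mpoly_ring_combination[OF this B'(1)] obtain F s where
      F: "finite F" "F \<subseteq> B" "\<forall>b\<in>F. s b \<in> carrier (mpoly_ring m)" "g = (\<Sum>b\<in>F. s b * b)"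
      by blast
    have Fc: "F \<subseteq> carrier (mpoly_ring m)" using F(2) B'(1) by blast
    have "g \<in> Idl\<^bsub>mpoly_ring m\<^esub> F"
      unfolding F(4)
    proof (rule ideal_mpoly_ring_sum[OF mpoly_ring.genideal_ideal[OF Fc]])
      fix b assume "b \<in> F"
      then show "s b * b \<in> Idl\<^bsub>mpoly_ring m\<^esub> F"
        using F(3) mpoly_ring.genideal_self[OF Fc]
        by (intro ideal_mpoly_ringD(4)[OF mpoly_ring.genideal_ideal[OF Fc]]) auto
    qed
    then show "\<exists>F. finite F \<and> F \<subseteq> B \<and> g \<in> Idl\<^bsub>mpoly_ring m\<^esub> F" using F(1,2) by blast
  qed
  from bchoice[OF this] obtain F where
    F: "\<And>g. g \<in> G \<Longrightarrow> finite (F g) \<and> F g \<subseteq> B \<and> g \<in> Idl\<^bsub>mpoly_ring m\<^esub> F g"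
    by blast
  define H where "H = (\<Union>g\<in>G. F g)"
  have H: "finite H" "H \<subseteq> B" "H \<subseteq> carrier (mpoly_ring m)"
    unfolding H_def using F G(1) B'(1) by auto
  have "g \<in> Idl\<^bsub>mpoly_ring m\<^esub> H" if g: "g \<in> G" for g
  proof -
    have "F g \<subseteq> H" using g unfolding H_def by blast
    then have "Idl\<^bsub>mpoly_ring m\<^esub> F g \<subseteq> Idl\<^bsub>mpoly_ring m\<^esub> H"
      by (rule mpoly_ring.subset_Idl_subset[OF H(3)])
    then show ?thesis using F[OF g] by blast
  qed
  then have "I \<subseteq> Idl\<^bsub>mpoly_ring m\<^esub> H"
    unfolding G(3) by (intro mpoly_ring.genideal_minimal mpoly_ring.genideal_ideal H(3)) blast
  moreover have "Idl\<^bsub>mpoly_ring m\<^esub> H \<subseteq> I"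
    unfolding B'(3)[symmetric] by (rule mpoly_ring.subset_Idl_subset[OF B'(1) H(2)])
  ultimately have "homogeneous_generating_set (mpoly_ring m) I H"
    using H B'(2) unfolding homogeneous_generating_set_def by blast
  then have "\<not> H \<subset> B" using B unfolding minimal_homogeneous_generating_set_def by blast
  then show ?thesis using H(1,2) by blast
qed

section \<open>Rooted labelings\<close>

text \<open>The path is extended one edge at a time; when the next vertex \<open>z\<close> already
  lies on it, it is cut off after \<open>z\<close>.\<close>

lemma simple_path_ex:
  assumes "(x, y) \<in> {(a, b). {a, b} \<in> E}\<^sup>*"
  shows "\<exists>xs. xs \<noteq> [] \<and> hd xs = x \<and> last xs = y \<and> distinct xs \<and>
    (\<forall>k. Suc k < length xs \<longrightarrow> {xs ! k, xs ! Suc k} \<in> E)"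
  using assms
proof (induction rule: rtrancl_induct)
  case base
  show ?case by (intro exI[of _ "[x]"]) simp
next
  case (step y z)
  then obtain xs where xs: "xs \<noteq> []" "hd xs = x" "last xs = y" "distinct xs"
    "\<And>k. Suc k < length xs \<Longrightarrow> {xs ! k, xs ! Suc k} \<in> E" and yz: "{y, z} \<in> E"
    by auto
  show ?case
  proof (cases "z \<in> set xs")
    case True
    then obtain i where i: "i < length xs" "xs ! i = z" by (auto simp: in_set_conv_nth)
    then have "last (take (Suc i) xs) = z" by (simp add: take_Suc_conv_app_nth)
    then show ?thesis using xs i by (intro exI[of _ "take (Suc i) xs"]) auto
  next
    case False
    have "{(xs @ [z]) ! k, (xs @ [z]) ! Suc k} \<in> E" if "Suc k < length (xs @ [z])" for k
    proof (cases "Suc k < length xs")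
      case False
      then have "k = length xs - 1" using that by simp
      then show ?thesis using xs(1,3) yz by (simp add: nth_append last_conv_nth)
    qed (use xs(5) in \<open>simp add: nth_append\<close>)
    then show ?thesis using xs False by (intro exI[of _ "xs @ [z]"]) auto
  qed
qed

text \<open>A simple path from \<open>a\<close> to \<open>b\<close> avoiding the edge has at least
  three vertices, since two would give the removed edge itself. The edge then closes it to a
  cycle.\<close>

lemma graph_cycle_ex:
  assumes "{a, b} \<in> E" "a \<noteq> b" "(a, b) \<in> {(u, v). {u, v} \<in> E - {{a, b}}}\<^sup>*"
  shows "\<exists>c. graph_cycle E c"
proof -
  obtain xs where xs: "xs \<noteq> []" "hd xs = a" "last xs = b" "distinct xs"
    "\<And>k. Suc k < length xs \<Longrightarrow> {xs ! k, xs ! Suc k} \<in> E - {{a, b}}"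
    using simple_path_ex[OF assms(3)] by blast
  have "length xs \<noteq> 1" using xs(1-3) assms(2) by (auto simp: length_Suc_conv)
  moreover have "length xs \<noteq> 2"
  proof
    assume "length xs = 2"
    then show False using xs(2,3) xs(5)[of 0] by (auto simp: length_Suc_conv numeral_2_eq_2)
  qed
  moreover have "length xs \<noteq> 0" using xs(1) by simp
  ultimately have "3 \<le> length xs" by linarith
  then have "graph_cycle E xs"
    using xs assms(1) by (auto simp: graph_cycle_def insert_commute)
  then show ?thesis ..
qed

text \<open>\<open>p k\<close> is the position, counted from 0, of the parent of the vertex at
  position \<open>k\<close>. It is monotone because children are appended in the order in which
  their parents are processed; the bound \<open>p k < i\<close> carries this through the next step,
  whose new vertices have parent \<open>i\<close>.\<close>

lemma bfs_parents:
  assumes "bfs V E i L"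
  shows "distinct L \<and> set L \<subseteq> V \<and> L \<noteq> [] \<and> i \<le> length L \<and>
    (\<exists>p. (\<forall>k. 1 \<le> k \<and> k < length L \<longrightarrow> p k < k \<and> p k < i \<and> {L ! p k, L ! k} \<in> E) \<and>
         (\<forall>j k. 1 \<le> j \<and> j \<le> k \<and> k < length L \<longrightarrow> p j \<le> p k))"
  using assms
proof (induction rule: bfs.induct)
  case (root r)
  then show ?case by auto
next
  case (process i L ns)
  then obtain p where
    p: "\<And>k. 1 \<le> k \<Longrightarrow> k < length L \<Longrightarrow> p k < k \<and> p k < i \<and> {L ! p k, L ! k} \<in> E"
      "\<And>j k. 1 \<le> j \<Longrightarrow> j \<le> k \<Longrightarrow> k < length L \<Longrightarrow> p j \<le> p k"
    by blast
  define q where "q k = (if k < length L then p k else i)" for k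
  have "q k < k \<and> q k < Suc i \<and> {(L @ ns) ! q k, (L @ ns) ! k} \<in> E"
    if k: "1 \<le> k" "k < length (L @ ns)" for k
  proof (cases "k < length L")
    case True
    then show ?thesis using p(1)[OF k(1) True] by (auto simp: q_def nth_append)
  next
    case False
    then have "(L @ ns) ! k \<in> set ns" using k(2) by (simp add: nth_append)
    then have "{L ! i, (L @ ns) ! k} \<in> E" using process.hyps(4) by blast
    then show ?thesis using False process.hyps(2) by (simp add: q_def nth_append)
  qed
  moreover have "q j \<le> q k" if "1 \<le> j" "j \<le> k" "k < length (L @ ns)" for j k
    using p(1)[of j] p(2)[of j k] that by (auto simp: q_def)
  moreover have "distinct (L @ ns)" "set (L @ ns) \<subseteq> V" using process by auto
  ultimately show ?case using process by auto
qed

text \<open>Parent edges alone connect every vertex to the root, so any further edge would lie on a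
  cycle.\<close>

lemma rooted_labeling_parents:
  assumes tree: "tree V E" and "rooted_labeling V E lab"
  shows "bij_betw lab V {1..card V} \<and> (\<exists>P. (\<forall>j\<in>{2..card V}. 1 \<le> P j \<and> P j < j) \<and>
    (\<forall>i j. 2 \<le> i \<and> i \<le> j \<and> j \<le> card V \<longrightarrow> P i \<le> P j) \<and>
    relabel_edges lab E = (\<lambda>j. {P j, j}) ` {2..card V})"
proof -
  from assms(2) obtain L where L: "bfs V E (length L) L" "set L = V"
    "\<And>k. k < length L \<Longrightarrow> lab (L ! k) = k + 1"
    unfolding rooted_labeling_def by blast
  from bfs_parents[OF L(1)] have dist: "distinct L" by blast
  from bfs_parents[OF L(1)] obtain p where
    p: "\<And>k. 1 \<le> k \<Longrightarrow> k < length L \<Longrightarrow> p k < k \<and> {L ! p k, L ! k} \<in> E"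
      "\<And>j k. 1 \<le> j \<Longrightarrow> j \<le> k \<Longrightarrow> k < length L \<Longrightarrow> p j \<le> p k"
    by blast
  define n where "n = card V"
  have n: "n = length L" using dist L(2) by (metis distinct_card n_def)
  have VL: "V = (!) L ` {..<n}" using L(2) n by (auto simp: set_conv_nth)
  \<comment> \<open>Shift from positions starting at 0 to labels starting at 1, in argument and
    value.\<close>
  define P where "P j = p (j - 1) + 1" for j
  have parent: "p b = a" if e: "{L ! a, L ! b} \<in> E" "a < b" "b < n" for a b
  proof (rule ccontr)
    assume ab: "p b \<noteq> a"
    let ?R = "{(u, v). {u, v} \<in> E - {{L ! a, L ! b}}}"
    \<comment> \<open>The parent edges avoid \<open>{L ! a, L ! b}\<close>: the parent of
      \<open>b\<close> is not \<open>a\<close> by assumption, and the parent of \<open>a\<close>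
      precedes \<open>a\<close>, hence is not \<open>b\<close>.\<close>
    have root: "(L ! 0, L ! k) \<in> ?R\<^sup>*" if "k < n" for k
      using that
    proof (induction k rule: less_induct)
      case (less k)
      show ?case
      proof (cases "k = 0")
        case False
        then have k: "p k < k" "{L ! p k, L ! k} \<in> E" using p(1)[of k] less.prems n by auto
        have "{L ! p k, L ! k} \<noteq> {L ! a, L ! b}"
          using k(1) less.prems e(2,3) ab dist n
          by (auto simp: doubleton_eq_iff nth_eq_iff_index_eq)
        then have "(L ! p k, L ! k) \<in> ?R" using k(2) by simp
        then show ?thesis using less.IH[of "p k"] k(1) less.prems
          by (meson less_trans rtrancl.rtrancl_into_rtrancl)
      qed simp
    qed
    have "sym ?R" by (auto simp: sym_def insert_commute)
    then have "(L ! a, L ! 0) \<in> ?R\<^sup>*"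
      using root[of a] e(2,3) by (meson less_trans sym_rtrancl symE)
    then have "(L ! a, L ! b) \<in> ?R\<^sup>*" using root[OF e(3)] by (rule rtrancl_trans)
    moreover have "L ! a \<noteq> L ! b" using e(2,3) dist n by (simp add: nth_eq_iff_index_eq)
    ultimately have "\<exists>c. graph_cycle E c" using graph_cycle_ex e(1) by metis
    then show False using tree by (simp add: tree_def)
  qed
  have "relabel_edges lab E = (\<lambda>j. {P j, j}) ` {2..n}"
  proof (intro subset_antisym subsetI)
    fix x assume "x \<in> relabel_edges lab E"
    then obtain e where e: "e \<in> E" "x = lab ` e" by (auto simp: relabel_edges_def)
    then have "e \<subseteq> V" "card e = 2" using tree by (auto simp: tree_def finite_simple_graph_def)
    then obtain u v where uv: "e = {u, v}" "u \<noteq> v" "u \<in> V" "v \<in> V"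
      by (auto simp: card_2_iff)
    then obtain a b where ab: "u = L ! a" "v = L ! b" "a < n" "b < n" unfolding VL by auto
    have *: "\<exists>j\<in>{2..n}. x = {P j, j}" if "e = {L ! a, L ! b}" "a < b" "b < n" for a b
    proof
      show "b + 1 \<in> {2..n}" using that by simp
      show "x = {P (b + 1), b + 1}"
        using that parent[of a b] e L(3) n by (simp add: P_def insert_commute)
    qed
    have "a < b \<or> b < a" using uv(2) ab by (cases a b rule: linorder_cases) auto
    then show "x \<in> (\<lambda>j. {P j, j}) ` {2..n}"
      using *[of a b] *[of b a] uv(1) ab by (auto simp: insert_commute)
  next
    fix x assume "x \<in> (\<lambda>j. {P j, j}) ` {2..n}"
    then obtain j where j: "2 \<le> j" "j \<le> n" "x = {P j, j}" by auto
    then have k: "1 \<le> j - 1" "j - 1 < length L" using n by auto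
    have "x = lab ` {L ! p (j - 1), L ! (j - 1)}"
      using L(3)[of "p (j - 1)"] L(3)[of "j - 1"] p(1)[OF k] k j by (simp add: P_def)
    then show "x \<in> relabel_edges lab E"
      unfolding relabel_edges_def using p(1)[OF k] by (rule image_eqI[OF _ conjunct2])
  qed
  moreover have "1 \<le> P j \<and> P j < j" if "j \<in> {2..n}" for j
  proof -
    have "1 \<le> j - 1" "j - 1 < length L" using that n by auto
    from p(1)[OF this] show ?thesis unfolding P_def by linarith
  qed
  moreover have "P i \<le> P j" if "2 \<le> i" "i \<le> j" "j \<le> n" for i j
  proof -
    have "1 \<le> i - 1" "i - 1 \<le> j - 1" "j - 1 < length L" using that n by auto
    from p(2)[OF this] show ?thesis by (simp add: P_def)
  qed
  moreover have "bij_betw lab V {1..n}"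
    unfolding bij_betw_def
  proof
    show "inj_on lab V" unfolding VL by (rule inj_onI) (use L(3) n in auto)
    have "lab ` V = Suc ` {..<n}" unfolding VL image_image by (rule image_cong) (use L(3) n in auto)
    then show "lab ` V = {1..n}" by (simp add: image_Suc_lessThan)
  qed
  ultimately show ?thesis unfolding n_def[symmetric] by (intro conjI exI[of _ P]) simp_all
qed

section \<open>Recognizing paths from the parent function\<close>

lemma path_graph_relabel:
  assumes "path_graph V E" "inj_on g V"
  shows "path_graph (g ` V) (relabel_edges g E)"
proof -
  obtain vs where vs: "vs \<noteq> []" "distinct vs" "set vs = V"
    "E = {{vs ! k, vs ! Suc k} | k. Suc k < length vs}"
    using assms(1) unfolding path_graph_def by blast
  have "relabel_edges g E = {{map g vs ! k, map g vs ! Suc k} | k. Suc k < length (map g vs)}"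
  proof (intro subset_antisym subsetI)
    fix x assume "x \<in> relabel_edges g E"
    then obtain k where "Suc k < length vs" "x = g ` {vs ! k, vs ! Suc k}"
      unfolding relabel_edges_def vs(4) by blast
    then have "x = {map g vs ! k, map g vs ! Suc k}" "Suc k < length (map g vs)" by auto
    then show "x \<in> {{map g vs ! k, map g vs ! Suc k} | k. Suc k < length (map g vs)}" by blast
  next
    fix x assume "x \<in> {{map g vs ! k, map g vs ! Suc k} | k. Suc k < length (map g vs)}"
    then obtain k where k: "Suc k < length vs" "x = g ` {vs ! k, vs ! Suc k}" by auto
    then have "{vs ! k, vs ! Suc k} \<in> E" unfolding vs(4) by blast
    then show "x \<in> relabel_edges g E" unfolding relabel_edges_def k(2) by (rule imageI)
  qed
  then show ?thesis
    unfolding path_graph_def using vs assms(2)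
    by (intro exI[of _ "map g vs"]) (simp add: distinct_map)
qed

lemma path_graph_of_bij:
  fixes n :: nat
  assumes "1 \<le> n" "bij_betw f {1..n} {1..n}"
  shows "path_graph {1..n} ((\<lambda>j. {f (j - 1), f j}) ` {2..n})"
proof -
  let ?vs = "map f [1..<Suc n]"
  have "set ?vs = {1..n}" using assms(2) by (simp add: bij_betw_def atLeastLessThanSuc_atLeastAtMost del: upt_Suc)
  moreover have "distinct ?vs"
    using assms(2) by (simp add: bij_betw_def distinct_map atLeastLessThanSuc_atLeastAtMost del: upt_Suc)
  moreover have "(\<lambda>j. {f (j - 1), f j}) ` {2..n} = {{?vs ! k, ?vs ! Suc k} | k. Suc k < length ?vs}"
  proof (intro subset_antisym subsetI)
    fix x assume "x \<in> (\<lambda>j. {f (j - 1), f j}) ` {2..n}"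
    then obtain j where j: "2 \<le> j" "j \<le> n" "x = {f (j - 1), f j}" by auto
    then obtain k where "j = 2 + k" using le_Suc_ex by blast
    with j have "x = {?vs ! k, ?vs ! Suc k}" "Suc k < length ?vs" by (auto simp del: upt_Suc)
    then show "x \<in> {{?vs ! k, ?vs ! Suc k} | k. Suc k < length ?vs}" by blast
  next
    fix x assume "x \<in> {{?vs ! k, ?vs ! Suc k} | k. Suc k < length ?vs}"
    then obtain k where "Suc k < n" "x = {f (Suc k), f (Suc (Suc k))}"
      by (auto simp del: upt_Suc)
    then show "x \<in> (\<lambda>j. {f (j - 1), f j}) ` {2..n}"
      by (intro image_eqI[of _ _ "Suc (Suc k)"]) auto
  qed
  ultimately show ?thesis
    unfolding path_graph_def using assms(1) by (intro exI[of _ ?vs]) (simp del: upt_Suc)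
qed

text \<open>
  The hypotheses leave only paths rooted at an end or next to one, where in the latter case the end
  has label \<open>2\<close> or \<open>3\<close>. For a path rooted further inside, hypothesis \<open>B\<close> fails.
\<close>

lemma path_graph_of_parents:
  fixes P :: "nat \<Rightarrow> nat"
  assumes n: "1 \<le> n"
    and P: "\<And>j. j \<in> {2..n} \<Longrightarrow> 1 \<le> P j \<and> P j < j"
    and A: "\<And>i. 1 \<le> i \<Longrightarrow> i + 3 \<le> n \<Longrightarrow> i < P (i + 3)"
    and B: "\<And>i. 1 \<le> i \<Longrightarrow> i + 2 \<le> n \<Longrightarrow> 2 \<le> P (i + 1) \<Longrightarrow> i < P (i + 2)"
  shows "path_graph {1..n} ((\<lambda>j. {P j, j}) ` {2..n})"
proof -
  have P2: "P 2 = 1" if "2 \<le> n" using P[of 2] that by force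
  have P3: "P 3 = 1 \<or> P 3 = 2" if "3 \<le> n" using P[of 3] that by force
  have P4: "P 4 = 3 \<or> P 4 = 2 \<and> P 3 = 1" if "4 \<le> n"
  proof -
    have "1 < P 4" using A[of 1] that by simp
    moreover have "2 < P 4" if "P 3 = 2" using B[of 2] \<open>4 \<le> n\<close> that by simp
    moreover have "P 4 < 4" using P[of 4] that by simp
    ultimately show ?thesis using P3 that by linarith
  qed
  have P5: "P j = j - 1" if j: "5 \<le> j" "j \<le> n" for j
  proof -
    obtain k where k: "j = 5 + k" using le_Suc_ex[OF j(1)] by blast
    \<comment> \<open>By \<open>A\<close> no vertex with label 4 or more is a child of 1, so the
      condition of \<open>B\<close> holds at label \<open>j - 1\<close>.\<close>
    then have "2 \<le> P (k + 3 + 1)" using A[of "k + 1"] j by (simp add: add.commute)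
    then have "k + 3 < P (k + 3 + 2)" using j k by (intro B) auto
    then show ?thesis using P[of j] j k by (simp add: add.commute)
  qed
  show ?thesis
  proof (cases "n \<le> 2 \<or> P 3 = 2")
    case True
    \<comment> \<open>The path 1, 2, ..., n rooted at an end.\<close>
    have "P j = j - 1" if j: "j \<in> {2..n}" for j
    proof -
      consider "j = 2" | "j = 3" | "j = 4" | "5 \<le> j" using j by fastforce
      then show ?thesis using P2 P4 P5 True j by cases auto
    qed
    then have "(\<lambda>j. {P j, j}) ` {2..n} = (\<lambda>j. {id (j - 1), id j}) ` {2..n}"
      by (intro image_cong) auto
    then show ?thesis using path_graph_of_bij[OF n bij_betw_id] by simp
  next
    case False
    then have n3: "3 \<le> n" "P 3 = 1" using P3 by auto
    show ?thesis
    proof (cases "n = 3 \<or> P 4 = 3")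
      case True
      \<comment> \<open>The path 2, 1, 3, 4, ...: the root is next to the end with label 2.\<close>
      define f :: "nat \<Rightarrow> nat" where "f = id(1 := 2, 2 := 1)"
      have "bij_betw f {1..n} {1..n}"
        by (rule bij_betw_byWitness[of _ f]) (use n3 in \<open>auto simp: f_def\<close>)
      moreover have "{P j, j} = {f (j - 1), f j}" if j: "j \<in> {2..n}" for j
      proof -
        consider "j = 2" | "j = 3" | "j = 4" | "5 \<le> j" using j by fastforce
        then show ?thesis using P2 n3 P5 True j by cases (auto simp: f_def)
      qed
      then have "(\<lambda>j. {P j, j}) ` {2..n} = (\<lambda>j. {f (j - 1), f j}) ` {2..n}" by (rule image_cong[OF refl])
      ultimately show ?thesis using path_graph_of_bij[OF n] by simp
    next
      case False
      then have n4: "4 \<le> n" "P 4 = 2" using n3(1) P4 by auto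
      \<comment> \<open>The path 3, 1, 2, 4, 5, ...: the end next to the root has label 3.\<close>
      define f :: "nat \<Rightarrow> nat" where "f = id(1 := 3, 2 := 1, 3 := 2)"
      have "bij_betw f {1..n} {1..n}"
        by (rule bij_betw_byWitness[of _ "id(1 := 2, 2 := 3, 3 := 1)"]) (use n3 in \<open>auto simp: f_def\<close>)
      moreover have "(\<lambda>j. {P j, j}) ` {2..n} = (\<lambda>j. {f (j - 1), f j}) ` {2..n}"
      proof -
        \<comment> \<open>The parent edges of 2 and 3 are the second and the first edge of this
          path, so these two are matched crosswise.\<close>
        have split: "{2..n} = insert 2 (insert 3 {4..n})" using n4(1) by auto
        have "{P j, j} = {f (j - 1), f j}" if j: "j \<in> {4..n}" for j
        proof -
          consider "j = 4" | "5 \<le> j" using j by fastforce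
          then show ?thesis using n4 P5 j by cases (auto simp: f_def)
        qed
        then have "(\<lambda>j. {P j, j}) ` {4..n} = (\<lambda>j. {f (j - 1), f j}) ` {4..n}"
          by (rule image_cong[OF refl])
        moreover have "{P 2, 2} = {f (3 - 1), f 3}" "{P 3, 3} = {f (2 - 1), f 2}"
          using P2 n3 by (auto simp: f_def)
        ultimately show ?thesis unfolding split image_insert by (simp only: insert_commute)
      qed
      ultimately show ?thesis using path_graph_of_bij[OF n] by simp
    qed
  qed
qed

section \<open>The evaluation point and the height bound\<close>

text \<open>Logarithmic form of x_{j+1} = x_j x_{P j + 1} / x_{P j}. As \<open>P j < j\<close>, all
  exponents on the right are known when \<open>e (j + 1)\<close> is defined.\<close>

lemma parallel_exponents_ex:
  fixes P :: "nat \<Rightarrow> nat"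
  assumes P: "\<And>j. r \<le> j \<Longrightarrow> j < N \<Longrightarrow> P j < j"
  shows "\<exists>e :: nat \<Rightarrow> (nat \<Rightarrow>\<^sub>0 int). (\<forall>j\<le>r. e j = Poly_Mapping.single j 1) \<and>
    (\<forall>j. r \<le> j \<and> j < N \<longrightarrow> e (j + 1) = e j + e (P j + 1) - e (P j))"
  using assms
proof (induction N)
  case 0
  show ?case by (intro exI[of _ "\<lambda>j. Poly_Mapping.single j 1"]) simp
next
  case (Suc N)
  then obtain e :: "nat \<Rightarrow> (nat \<Rightarrow>\<^sub>0 int)" where e: "\<And>j. j \<le> r \<Longrightarrow> e j = Poly_Mapping.single j 1"
    "\<And>j. r \<le> j \<Longrightarrow> j < N \<Longrightarrow> e (j + 1) = e j + e (P j + 1) - e (P j)"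
    by auto
  show ?case
  proof (cases "r \<le> N")
    case True
    define e' where "e' = e (N + 1 := e N + e (P N + 1) - e (P N))"
    have "e' (j + 1) = e' j + e' (P j + 1) - e' (P j)" if "r \<le> j" "j < Suc N" for j
      using e(2)[of j] Suc.prems[of j] that by (auto simp: e'_def less_Suc_eq)
    moreover have "e' j = Poly_Mapping.single j 1" if "j \<le> r" for j
      using e(1) that True by (simp add: e'_def)
    ultimately show ?thesis by blast
  next
    case False
    then show ?thesis using e by (intro exI[of _ e]) auto
  qed
qed

text \<open>
  The variables in \<open>Z\<close> are sent to zero. From index \<open>r\<close> on, the relation of vertex \<open>j\<close> is solved for
  \<open>x\<^sub>j\<^sub>+\<^sub>1\<close>; the remaining relations must vanish because of \<open>Z\<close>.
\<close>

lemma hankel_height_le: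
  fixes P :: "nat \<Rightarrow> nat"
  assumes P: "\<And>j. j \<in> {2..n} \<Longrightarrow> 1 \<le> P j \<and> P j < j"
    and r: "2 \<le> r" "r \<le> n + 1"
    and Z: "\<And>j. j \<in> {2..n} \<Longrightarrow> r \<le> j \<and> {P j, P j + 1, j, j + 1} \<inter> Z = {} \<or>
      (P j \<in> Z \<or> j + 1 \<in> Z) \<and> (j \<in> Z \<or> P j + 1 \<in> Z)"
    and G: "G = (\<lambda>j. hankel_binomial (P j) j :: ('k::field) mpoly) ` {2..n}"
  shows "ideal_height (mpoly_ring (n + 1)) (Idl\<^bsub>mpoly_ring (n + 1)\<^esub> G) \<le> enat (n + 1 - card ({1..r} - Z))"
proof -
  have "P j < j" if "r \<le> j" "j < n + 1" for j using P[of j] r that by auto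
  from parallel_exponents_ex[of r "n + 1" P, OF this] obtain e :: "nat \<Rightarrow> (nat \<Rightarrow>\<^sub>0 int)" where
    e: "\<And>j. j \<le> r \<Longrightarrow> e j = Poly_Mapping.single j 1"
    "\<And>j. r \<le> j \<Longrightarrow> j < n + 1 \<Longrightarrow> e (j + 1) = e j + e (P j + 1) - e (P j)"
    by blast
  \<comment> \<open>Exponents exist also at indices in \<open>Z\<close>; there the value is
    overridden by zero.\<close>
  define x :: "nat \<Rightarrow> 'k laurent" where
    "x j = (if j \<in> Z then 0 else Poly_Mapping.single (e j) 1)" for j
  show ?thesis
  proof (rule ideal_height_le)
    show "{1..r} - Z \<subseteq> {1..n + 1}" using r by auto
    show "x i = Poly_Mapping.single (Poly_Mapping.single i 1) 1" if "i \<in> {1..r} - Z" for i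
      using that e(1) by (simp add: x_def)
    show "G \<subseteq> carrier (mpoly_ring (n + 1))"
    proof -
      have "(hankel_binomial (P j) j :: 'k mpoly) \<in> carrier (mpoly_ring (n + 1))" if "j \<in> {2..n}" for j
        using P[OF that] that by (intro hankel_binomial_in_mpoly_ring) auto
      then show ?thesis unfolding G by blast
    qed
    fix g assume "g \<in> G"
    then obtain j where j: "j \<in> {2..n}" "g = hankel_binomial (P j) j" unfolding G by blast
    \<comment> \<open>Either both sides are Laurent monomials with the same exponent, or each side
      has a factor that is zero by \<open>Z\<close>.\<close>
    have "x (P j) * x (j + 1) = x j * x (P j + 1)"
    proof (cases "r \<le> j \<and> {P j, P j + 1, j, j + 1} \<inter> Z = {}")
      case True
      then have "e (j + 1) = e j + e (P j + 1) - e (P j)" using e(2)[of j] j by auto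
      then show ?thesis using True by (auto simp: x_def mult_single)
    next
      case False
      then show ?thesis using Z[OF j(1)] by (auto simp: x_def)
    qed
    then show "eval_laurent x g = 0"
      by (simp add: j(2) hankel_binomial_def eval_laurent_diff eval_laurent_mult)
  qed
qed

text \<open>The negations of \<open>?A\<close> and \<open>?B\<close> are the hypotheses that force a
  path. The conclusion records \<open>2 \<le> n\<close> because \<open>n - 2\<close> is truncated
  subtraction.\<close>

lemma parents_height_le:
  fixes P :: "nat \<Rightarrow> nat"
  assumes P: "\<And>j. j \<in> {2..n} \<Longrightarrow> 1 \<le> P j \<and> P j < j"
    and mono: "\<And>i j. 2 \<le> i \<Longrightarrow> i \<le> j \<Longrightarrow> j \<le> n \<Longrightarrow> P i \<le> P j"
    and G: "G = (\<lambda>j. hankel_binomial (P j) j :: ('k::field) mpoly) ` {2..n}"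
    and n: "1 \<le> n" and not_path: "\<not> path_graph {1..n} ((\<lambda>j. {P j, j}) ` {2..n})"
  shows "2 \<le> n \<and> ideal_height (mpoly_ring (n + 1)) (Idl\<^bsub>mpoly_ring (n + 1)\<^esub> G) \<le> enat (n - 2)"
proof -
  \<comment> \<open>As \<open>P\<close> is monotone, \<open>?A i\<close> says that
    \<open>i + 1\<close>, \<open>i + 2\<close> and \<open>i + 3\<close> are labeled once
    \<open>i\<close> is processed; \<open>?B i\<close> says that \<open>i + 1\<close> and
    \<open>i + 2\<close> are, and that no child of 1 has a label above \<open>i\<close>.\<close>
  let ?A = "\<lambda>i. 1 \<le> i \<and> i + 3 \<le> n \<and> P (i + 3) \<le> i"
  let ?B = "\<lambda>i. 1 \<le> i \<and> i + 2 \<le> n \<and> 2 \<le> P (i + 1) \<and> P (i + 2) \<le> i"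
  have "(\<exists>i. ?A i) \<or> (\<exists>i. ?B i)"
  proof (rule ccontr)
    assume *: "\<not> ?thesis"
    have "i < P (i + 3)" if "1 \<le> i" "i + 3 \<le> n" for i
    proof (rule ccontr)
      assume "\<not> i < P (i + 3)"
      with that have "?A i" by simp
      with * show False by blast
    qed
    moreover have "i < P (i + 2)" if "1 \<le> i" "i + 2 \<le> n" "2 \<le> P (i + 1)" for i
    proof (rule ccontr)
      assume "\<not> i < P (i + 2)"
      with that have "?B i" by simp
      with * show False by blast
    qed
    ultimately have "path_graph {1..n} ((\<lambda>j. {P j, j}) ` {2..n})"
      using n P by (intro path_graph_of_parents) simp_all
    then show False using not_path by simp
  qed
  then show ?thesis
  proof
    assume ex: "\<exists>i. ?A i"
    define i where "i = (GREATEST i. ?A i)"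
    have i: "?A i" unfolding i_def using ex by (rule GreatestI_ex_nat[where b = n]) auto
    have max: "k \<le> i" if "?A k" for k
      unfolding i_def using that by (rule Greatest_le_nat[where b = n]) auto
    \<comment> \<open>Maximality makes \<open>?A (i + 1)\<close> fail, so the relations from vertex
      \<open>i + 4\<close> on involve no variable that is set to zero.\<close>
    have big: "i + 2 \<le> P j" if "i + 4 \<le> j" "j \<le> n" for j
    proof -
      have "\<not> ?A (i + 1)" using max[of "i + 1"] by auto
      then have "i + 1 < P (i + 1 + 3)" using that by (auto simp: not_le)
      moreover have "P (i + 1 + 3) \<le> P j" using that by (intro mono) auto
      ultimately show ?thesis by linarith
    qed
    have small: "P j \<le> i" if "2 \<le> j" "j \<le> i + 3" for j
      using mono[of j "i + 3"] that i by auto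
    \<comment> \<open>Up to vertex \<open>i + 3\<close> the relations vanish because
      \<open>P j\<close> and \<open>P j + 1\<close> are at most \<open>i + 1\<close>. The free
      variables are x_{i+2}, x_{i+3}, x_{i+4}.\<close>
    have "ideal_height (mpoly_ring (n + 1)) (Idl\<^bsub>mpoly_ring (n + 1)\<^esub> G)
        \<le> enat (n + 1 - card ({1..i + 4} - {..i + 1}))"
    proof (rule hankel_height_le[OF P _ _ _ G])
      fix j assume j: "j \<in> {2..n}"
      show "i + 4 \<le> j \<and> {P j, P j + 1, j, j + 1} \<inter> {..i + 1} = {} \<or>
        (P j \<in> {..i + 1} \<or> j + 1 \<in> {..i + 1}) \<and> (j \<in> {..i + 1} \<or> P j + 1 \<in> {..i + 1})"
        using big[of j] small[of j] j by (cases "i + 4 \<le> j") auto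
    qed (use i in auto)
    moreover have "{1..i + 4} - {..i + 1} = {i + 2, i + 3, i + 4}" by auto
    then have "n + 1 - card ({1..i + 4} - {..i + 1}) = n - 2" by simp
    ultimately show ?thesis using i by (simp only:) simp
  next
    assume ex: "\<exists>i. ?B i"
    define i where "i = (GREATEST i. ?B i)"
    have i: "?B i" unfolding i_def using ex by (rule GreatestI_ex_nat[where b = n]) auto
    have max: "k \<le> i" if "?B k" for k
      unfolding i_def using that by (rule Greatest_le_nat[where b = n]) auto
    \<comment> \<open>The value 1 is impossible because vertex 2 is a child of 1.\<close>
    have i2: "2 \<le> i" using i P[of 2] by (cases "i = 1") (auto simp: numeral_2_eq_2)
    have up: "2 \<le> P j" if "i + 1 \<le> j" "j \<le> n" for j
      using mono[of "i + 1" j] i that by auto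
    \<comment> \<open>By \<open>up\<close> the condition on the children of 1 persists, so
      \<open>?B (i + 1)\<close> can only fail at \<open>P (i + 3)\<close>.\<close>
    have big: "i + 2 \<le> P j" if "i + 3 \<le> j" "j \<le> n" for j
    proof -
      have "\<not> ?B (i + 1)" using max[of "i + 1"] by auto
      moreover have "2 \<le> P (i + 1 + 1)" using that by (intro up) auto
      ultimately have "i + 1 < P (i + 1 + 2)" using that by (auto simp: not_le)
      moreover have "P (i + 1 + 2) \<le> P j" using that by (intro mono) auto
      ultimately show ?thesis by linarith
    qed
    have small: "P j \<le> i" if "2 \<le> j" "j \<le> i + 2" for j
      using mono[of j "i + 2"] that i by auto
    \<comment> \<open>Here x_1 stays free, together with x_{i+2} and x_{i+3}.\<close>
    have "ideal_height (mpoly_ring (n + 1)) (Idl\<^bsub>mpoly_ring (n + 1)\<^esub> G)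
        \<le> enat (n + 1 - card ({1..i + 3} - {2..i + 1}))"
    proof (rule hankel_height_le[OF P _ _ _ G])
      fix j assume j: "j \<in> {2..n}"
      show "i + 3 \<le> j \<and> {P j, P j + 1, j, j + 1} \<inter> {2..i + 1} = {} \<or>
        (P j \<in> {2..i + 1} \<or> j + 1 \<in> {2..i + 1}) \<and> (j \<in> {2..i + 1} \<or> P j + 1 \<in> {2..i + 1})"
      proof (cases "i + 3 \<le> j")
        case True
        then show ?thesis using big[of j] j by auto
      next
        case False
        then have "P j \<le> i" using small j by auto
        \<comment> \<open>For a child of 1 the factor x_1 is not zero, so its relation must vanish
          through \<open>j\<close> and \<open>j + 1\<close>, which lie in the zero set once
          \<open>j \<le> i\<close>.\<close>
        moreover have "j \<le> i" if "P j < 2"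
        proof (rule ccontr)
          assume "\<not> j \<le> i"
          then have "2 \<le> P j" using j by (intro up) auto
          with \<open>P j < 2\<close> show False by simp
        qed
        ultimately show ?thesis using P[OF j] j i2 by (cases "P j < 2") auto
      qed
    qed (use i in auto)
    moreover have "{1..i + 3} - {2..i + 1} = {1, i + 2, i + 3}" using i2 by auto
    then have "n + 1 - card ({1..i + 3} - {2..i + 1}) = n - 2" using i2 by simp
    ultimately show ?thesis using i by (simp only:) simp
  qed
qed

section \<open>The height of the Hankel edge ideal against its number of generators\<close>

theorem theorem3p1:
  fixes V :: "'v set" and E :: "'v set set" and lab :: "'v \<Rightarrow> nat" and n :: nat
    and S :: "('k::field) mpoly ring" and I_T :: "'k mpoly set"
  defines "S \<equiv> mpoly_ring (n + 1)"
    and "I_T \<equiv> hankel_edge_ideal n (relabel_edges lab E)"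
  assumes "tree V E" and "card V = n"
    and "rooted_labeling V E lab"
    and "\<not> path_graph V E"
  shows "ideal_height S I_T \<le> enat (n - 2) \<and> \<not> complete_intersection S I_T"
proof -
  note parents = rooted_labeling_parents[OF assms(3,5), unfolded \<open>card V = n\<close>]
  from parents have bij: "bij_betw lab V {1..n}" by (rule conjunct1)
  from conjunct2[OF parents] obtain P where "\<forall>j\<in>{2..n}. 1 \<le> P j \<and> P j < j"
    "\<forall>i j. 2 \<le> i \<and> i \<le> j \<and> j \<le> n \<longrightarrow> P i \<le> P j"
    and edges: "relabel_edges lab E = (\<lambda>j. {P j, j}) ` {2..n}"
    by (elim exE conjE)
  then have P: "\<And>j. j \<in> {2..n} \<Longrightarrow> 1 \<le> P j \<and> P j < j"
    "\<And>i j. 2 \<le> i \<Longrightarrow> i \<le> j \<Longrightarrow> j \<le> n \<Longrightarrow> P i \<le> P j"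
    by blast+
  have graph: "finite V" "V \<noteq> {}" "\<And>e. e \<in> E \<Longrightarrow> e \<subseteq> V"
    using assms(3) by (auto simp: tree_def finite_simple_graph_def connected_graph_def)
  then have n: "1 \<le> n" using \<open>card V = n\<close> by (auto simp: Suc_le_eq card_gt_0_iff)
  define G :: "'k mpoly set" where "G = (\<lambda>j. hankel_binomial (P j) j) ` {2..n}"
  have G: "finite G" "G \<subseteq> carrier (mpoly_ring (n + 1))" "\<And>g. g \<in> G \<Longrightarrow> homogeneous g"
  proof -
    show "G \<subseteq> carrier (mpoly_ring (n + 1))"
    proof
      fix g assume "g \<in> G"
      then obtain j where j: "j \<in> {2..n}" "g = hankel_binomial (P j) j" unfolding G_def by blast
      then show "g \<in> carrier (mpoly_ring (n + 1))"
        unfolding j(2) using P(1)[OF j(1)] by (intro hankel_binomial_in_mpoly_ring) auto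
    qed
  qed (auto simp: G_def homogeneous_hankel_binomial)
  have "{hankel_binomial i j :: 'k mpoly | i j. i < j \<and> {i, j} \<in> relabel_edges lab E} = G"
  proof (intro subset_antisym subsetI)
    fix g :: "'k mpoly" assume "g \<in> {hankel_binomial i j | i j. i < j \<and> {i, j} \<in> relabel_edges lab E}"
    then obtain i j k where "i < j" "k \<in> {2..n}" "{i, j} = {P k, k}" "g = hankel_binomial i j"
      unfolding edges by blast
    moreover from this have "i = P k" "j = k" using P(1)[of k] by (auto simp: doubleton_eq_iff)
    ultimately show "g \<in> G" unfolding G_def by blast
  next
    fix g assume "g \<in> G"
    then obtain j where "j \<in> {2..n}" "g = hankel_binomial (P j) j" unfolding G_def by blast
    then show "g \<in> {hankel_binomial i j | i j. i < j \<and> {i, j} \<in> relabel_edges lab E}"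
      using P(1)[of j] unfolding edges by blast
  qed
  then have I_T: "I_T = Idl\<^bsub>S\<^esub> G"
    unfolding I_T_def S_def hankel_edge_ideal_def by simp
  \<comment> \<open>The inverse of the labeling would carry a path on the labels back to a path on
    \<open>V\<close>.\<close>
  have not_path: "\<not> path_graph {1..n} ((\<lambda>j. {P j, j}) ` {2..n})"
  proof
    let ?h = "inv_into V lab"
    assume "path_graph {1..n} ((\<lambda>j. {P j, j}) ` {2..n})"
    then have "path_graph (?h ` {1..n}) (relabel_edges ?h (relabel_edges lab E))"
      unfolding edges[symmetric] using bij_betw_inv_into[OF bij]
      by (intro path_graph_relabel) (auto simp: bij_betw_def)
    moreover have "?h ` {1..n} = V" using bij_betw_inv_into[OF bij] by (simp add: bij_betw_def)
    moreover have "?h ` lab ` e = e" if "e \<in> E" for e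
      using bij graph(3)[OF that] by (auto simp: bij_betw_def intro!: inv_into_image_cancel)
    then have "relabel_edges ?h (relabel_edges lab E) = E"
      unfolding relabel_edges_def image_image by simp
    ultimately show False using assms(6) by simp
  qed
  have "2 \<le> n \<and> ideal_height S I_T \<le> enat (n - 2)"
    unfolding I_T S_def by (rule parents_height_le[OF _ _ G_def n not_path]) (fact P)+
  then have height: "2 \<le> n" "ideal_height S I_T \<le> enat (n - 2)" by simp_all
  \<comment> \<open>The very set whose cardinality \<open>num_generators\<close> takes.\<close>
  define B where "B = (SOME B. minimal_homogeneous_generating_set S I_T B)"
  have "homogeneous_generating_set S I_T G"
    using G unfolding homogeneous_generating_set_def I_T S_def by simp
  then have "\<exists>B. minimal_homogeneous_generating_set S I_T B"
    by (rule minimal_homogeneous_generating_set_ex[OF G(1)])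
  then have B: "minimal_homogeneous_generating_set S I_T B"
    unfolding B_def by (rule someI_ex)
  then have B': "B \<subseteq> carrier (mpoly_ring (n + 1))"
    "Idl\<^bsub>mpoly_ring (n + 1)\<^esub> B = Idl\<^bsub>mpoly_ring (n + 1)\<^esub> G"
    by (simp_all add: minimal_homogeneous_generating_set_def homogeneous_generating_set_def I_T S_def)
  have "finite B"
    by (rule minimal_homogeneous_generating_set_finite[OF G(1,2) refl B[unfolded I_T S_def]])
  then have "n - 1 \<le> card B"
    by (rule card_generators_ge[OF _ G_def B'(1) _ B'(2), rotated]) (fact P(1))
  \<comment> \<open>With \<open>2 \<le> n\<close>, truncated subtraction still gives
    \<open>n - 2 < n - 1\<close>.\<close>
  then have "n - 2 < num_generators S I_T"
    using height(1) unfolding num_generators_def B_def[symmetric] by linarith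
  then have "ideal_height S I_T < enat (num_generators S I_T)"
    using height(2) by (metis enat_ord_simps(2) le_less_trans)
  then have "\<not> complete_intersection S I_T"
    unfolding complete_intersection_def by simp
  with height(2) show ?thesis by blast
qed

end
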